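(* Let $G$ be a finite simple graph with $n \geq 4$ vertices and fewer than $\frac{80n-134}{31}$ edges. Then $G$ has a bipartite cut, i.e. there is a set $M \subset V(G)$ such that $G - M$ is disconnected and the subgraph of $G$ induced on $M$ is bipartite.
   Context: Graphs are finite, undirected, without loops or multiple edges. A vertex cut of $G$ is a subset $M \subset V(G)$ whose removal disconnects $G$. A bipartite cut is a vertex cut $M$ such that the induced subgraph $G[M]$ is bipartite. *)

theory Defs
  imports Complex_Main "Graph_Theory.Graph_Theory"
begin

text \<open>
  A finite simple graph is a \<^locale>\<open>Digraph.graph\<close> of the library: a finite, loop-free digraph without
  parallel arcs whose arc relation is symmetric. An undirected edge $\{u,v\}$ is thus represented by
  the two arcs from $u$ to $v$ and from $v$ to $u$. Identifying an edge with its set of end vertices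
  makes the two arcs count once.
\<close>

definition edge_set :: "('a, 'b) pre_digraph \<Rightarrow> 'a set set" where
  "edge_set G = (\<lambda>e. {tail G e, head G e}) ` arcs G"

definition bipartite :: "('a, 'b) pre_digraph \<Rightarrow> bool" where
  "bipartite G \<longleftrightarrow> (\<exists>A B. verts G = A \<union> B \<and> A \<inter> B = {} \<and>
     (\<forall>e\<in>arcs G. tail G e \<in> A \<and> head G e \<in> B \<or> tail G e \<in> B \<and> head G e \<in> A))"

text \<open>
  The library's \<^const>\<open>Digraph_Component.connected\<close> is false for the graph without vertices. Such a
  graph must not count as disconnected here, since otherwise \<open>verts G\<close> itself would be a vertex cut.
\<close>

definition disconnected :: "('a, 'b) pre_digraph \<Rightarrow> bool" where
  "disconnected G \<longleftrightarrow> verts G \<noteq> {} \<and> \<not> Digraph_Component.connected G"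

definition vertex_cut :: "('a, 'b) pre_digraph \<Rightarrow> 'a set \<Rightarrow> bool" where
  "vertex_cut G M \<longleftrightarrow> M \<subseteq> verts G \<and> disconnected (G \<restriction> (verts G - M))"

definition bipartite_cut :: "('a, 'b) pre_digraph \<Rightarrow> 'a set \<Rightarrow> bool" where
  "bipartite_cut G M \<longleftrightarrow> vertex_cut G M \<and> bipartite (G \<restriction> M)"

end

theory Submission
  imports Defs
begin

text \<open>
  Take a minimal counterexample. Identifying two nonadjacent vertices never creates a bipartite cut
  (the two preimages get the same side or the same colour), and deleting a vertex never does if its
  degree is at most 3 or its neighbourhood is a clique. A sequence of such steps that loses $k$ vertices and at
  least $80k/31$ edges is therefore impossible. Hence nonadjacent vertices have at most two common
  neighbours and all degrees are at least 4. Call a vertex low if its degree is at most 5 and high otherwise.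
  As the neighbourhood of any small connected set contains an odd cycle, two adjacent low vertices lie in a
  common $K_4$ only if they lie in a $K_5$, and a $K_5$ has at most two low vertices. It follows that
  a vertex of degree 4 has a triangle of high neighbours, and that a vertex of degree 5 has at
  least two high neighbours: if its neighbourhood is triangle-free, it is a pentagon, and with four
  low vertices on the pentagon some triangle would be surrounded by a hexagon spanning a bipartite graph.
  Discharging $\deg(v)/2 - 80/31$ from high to low vertices then contradicts the edge count.
\<close>

section \<open>Labellings, identification and deletion\<close>

text \<open>A bipartite neighbourhood is a cut only if some vertex lies beyond it, so every cut
  argument needs a lower bound on the order. It comes from the additive constant: with all degrees
  at least 4, the edge bound forces at least 8 vertices, and vertices of degree 5 raise this to 9 or
  10. The same constant lets K_4, with 6 = (80 * 4 - 134) / 31 edges, meet the bound exactly, which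
  rules out counterexamples on 4 vertices. The bound means an average degree below 160/31, a number
  between 5 and 6: hence low means degree at most 5. Identifying over two common neighbours loses
  too little, as 2 < 80/31. The delicate configurations therefore combine several steps, chosen so
  that an earlier identification creates a common neighbour for a later one, or prepares a vertex
  for deletion.\<close>

text \<open>
  A bipartite cut is encoded as a labelling of the vertices: \<open>Lft\<close> and \<open>Rgt\<close> are two sides separated
  by the cut, \<open>Zero\<close> and \<open>One\<close> the colour classes of the cut. Edges are pairs of opposite arcs, so the
  cardinality of the arc relation is twice the number of edges.
\<close>

datatype label = Lft | Rgt | Zero | One

fun conflict :: "label \<Rightarrow> label \<Rightarrow> bool" where
  "conflict Lft Rgt \<longleftrightarrow> True"
| "conflict Rgt Lft \<longleftrightarrow> True"
| "conflict Zero Zero \<longleftrightarrow> True"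
| "conflict One One \<longleftrightarrow> True"
| "conflict _ _ \<longleftrightarrow> False"

lemma conflict_sym: "conflict a b \<Longrightarrow> conflict b a"
  by (cases a; cases b) auto

lemma conflict_unique: "conflict a b \<Longrightarrow> conflict a c \<Longrightarrow> b = c"
  by (cases a; cases b; cases c) auto

lemma UNIV_label: "(UNIV :: label set) = {Lft, Rgt, Zero, One}"
  using label.exhaust by auto

definition sgraph :: "'a set \<Rightarrow> 'a rel \<Rightarrow> bool" where
  "sgraph V R \<longleftrightarrow> finite V \<and> R \<subseteq> V \<times> V \<and> sym R \<and> irrefl R"

definition labelling :: "'a rel \<Rightarrow> ('a \<Rightarrow> label) \<Rightarrow> bool" where
  "labelling R f \<longleftrightarrow> (\<forall>x y. (x, y) \<in> R \<longrightarrow> \<not> conflict (f x) (f y))"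

text \<open>The colour classes may be empty: labelling one component \<open>Lft\<close> and the rest
  \<open>Rgt\<close> shows that a disconnected graph is not \<open>uncut\<close>.\<close>

definition uncut :: "'a set \<Rightarrow> 'a rel \<Rightarrow> bool" where
  "uncut V R \<longleftrightarrow> sgraph V R \<and> (\<forall>f. labelling R f \<longrightarrow> \<not> (Lft \<in> f ` V \<and> Rgt \<in> f ` V))"

text \<open>The merged vertex keeps the name \<open>x\<close>, so the reduced graph has the same
  vertex type; parallel edges collapse because arcs form a set.\<close>

definition identify :: "'a \<Rightarrow> 'a \<Rightarrow> 'a rel \<Rightarrow> 'a rel" where
  "identify x y R = map_prod (id(y := x)) (id(y := x)) ` R"

definition delete_vertex :: "'a \<Rightarrow> 'a rel \<Rightarrow> 'a rel" where
  "delete_vertex v R = {(x, y) \<in> R. x \<noteq> v \<and> y \<noteq> v}"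

lemma sgraphD:
  assumes "sgraph V R"
  shows "finite V" "finite R" "(x, y) \<in> R \<Longrightarrow> (y, x) \<in> R" "(x, x) \<notin> R"
    "(x, y) \<in> R \<Longrightarrow> x \<in> V" "(x, y) \<in> R \<Longrightarrow> y \<in> V"
  using assms finite_subset[of R "V \<times> V"] unfolding sgraph_def sym_def irrefl_def by auto

lemma identify_iff:
  "(u, w) \<in> identify x y R \<longleftrightarrow>
    (\<exists>u' w'. (u', w') \<in> R \<and> u = (if u' = y then x else u') \<and> w = (if w' = y then x else w'))"
proof -
  have "map_prod (id(y := x)) (id(y := x)) e =
      (if fst e = y then x else fst e, if snd e = y then x else snd e)" for e
    by (cases e) simp
  then show ?thesis
    unfolding identify_def image_iff Bex_def by (simp only: split_paired_Ex fst_conv snd_conv prod.inject)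
qed

lemma identifyI:
  "(u, w) \<in> R \<Longrightarrow> u \<noteq> y \<Longrightarrow> w \<noteq> y \<Longrightarrow> (u, w) \<in> identify x y R"
  unfolding identify_def by (rule rev_image_eqI[of "(u, w)"]) auto

lemma identifyI_right: "(u, y) \<in> R \<Longrightarrow> u \<noteq> y \<Longrightarrow> (u, x) \<in> identify x y R"
  unfolding identify_def by (rule rev_image_eqI[of "(u, y)"]) auto

lemma identify_uncut:
  assumes G: "uncut V R" and x: "x \<in> V" and y: "y \<in> V" and xy: "x \<noteq> y" "(x, y) \<notin> R"
  shows "uncut (V - {y}) (identify x y R)"
proof -
  have S: "sgraph V R" using G by (simp add: uncut_def)
  note d = sgraphD[OF S]
  have "sgraph (V - {y}) (identify x y R)"
    unfolding sgraph_def
  proof (intro conjI)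
    show "finite (V - {y})" using d by simp
    show "identify x y R \<subseteq> (V - {y}) \<times> (V - {y})"
      using d(5,6) x xy by (auto simp: identify_iff split: if_splits)
    show "sym (identify x y R)"
      unfolding sym_def identify_iff using d(3) by (intro allI impI, elim exE conjE) (intro exI conjI, auto)
    show "irrefl (identify x y R)"
      unfolding irrefl_def identify_iff using d(3,4) xy by (auto split: if_splits)
  qed
  moreover have False if f: "labelling (identify x y R) f"
    and LR: "Lft \<in> f ` (V - {y})" "Rgt \<in> f ` (V - {y})" for f
  proof -
    let ?g = "f(y := f x)"
    have "labelling R ?g"
      unfolding labelling_def
    proof (intro allI impI)
      fix u w assume "(u, w) \<in> R"
      then have "(if u = y then x else u, if w = y then x else w) \<in> identify x y R"
        unfolding identify_def by (intro rev_image_eqI[where x = "(u, w)"]) auto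
      then have "\<not> conflict (f (if u = y then x else u)) (f (if w = y then x else w))"
        using f unfolding labelling_def by blast
      moreover have "?g z = f (if z = y then x else z)" for z by simp
      ultimately show "\<not> conflict (?g u) (?g w)" by simp
    qed
    moreover have "Lft \<in> ?g ` V" "Rgt \<in> ?g ` V" using LR by force+
    ultimately show False using G unfolding uncut_def by blast
  qed
  ultimately show ?thesis unfolding uncut_def by blast
qed

text \<open>For a common neighbour \<open>c\<close>, the arcs between \<open>y\<close> and
  \<open>c\<close> have the same images as those between \<open>x\<close> and \<open>c\<close>.
  Removing them first does not change the image.\<close>

lemma identify_card:
  assumes S: "sgraph V R" and xy: "x \<noteq> y" and C: "C \<subseteq> R `` {x} \<inter> R `` {y}"
  shows "card (identify x y R) + 2 * card C \<le> card R"
proof -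
  note d = sgraphD[OF S]
  define D where "D = {y} \<times> C \<union> C \<times> {y}"
  have fC: "finite C" by (rule finite_subset[OF C]) (use d(2) finite_Image in blast)
  have yC: "y \<notin> C" and xC: "x \<notin> C" using C d(4) by auto
  have cD: "card D = 2 * card C"
    unfolding D_def using fC yC by (subst card_Un_disjoint) (auto simp: card_cartesian_product)
  have DR: "D \<subseteq> R" unfolding D_def using C d(3) by auto
  let ?p = "map_prod (id(y := x)) (id(y := x))"
  have "?p ` D \<subseteq> ?p ` (R - D)"
  proof
    fix e assume "e \<in> ?p ` D"
    then obtain c where c: "c \<in> C" "e = (x, c) \<or> e = (c, x)"
      unfolding D_def using yC by (auto split: if_splits)
    then have "(x, c) \<in> R - D" "(c, x) \<in> R - D" using C d(3) xy yC unfolding D_def by auto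
    moreover have "?p (x, c) = (x, c)" "?p (c, x) = (c, x)" using c xy yC by auto
    ultimately show "e \<in> ?p ` (R - D)" using c(2) by (metis image_eqI)
  qed
  then have "identify x y R = ?p ` (R - D)"
    unfolding identify_def using image_Un[of ?p "R - D" D] DR by (simp add: Un_absorb2)
  then have "card (identify x y R) \<le> card (R - D)"
    using d(2) by (simp add: card_image_le)
  also have "\<dots> = card R - card D" using DR d(2) card_Diff_subset finite_subset by metis
  finally show ?thesis using cD card_mono[OF d(2) DR] by linarith
qed

lemma delete_vertex_card:
  assumes S: "sgraph V R"
  shows "card (delete_vertex v R) + 2 * card (R `` {v}) = card R"
proof -
  note d = sgraphD[OF S]
  let ?N = "R `` {v}"
  have fN: "finite ?N" using d(2) finite_Image by blast
  have vN: "v \<notin> ?N" using d(4) by auto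
  define D where "D = {v} \<times> ?N \<union> ?N \<times> {v}"
  have cD: "card D = 2 * card ?N"
    unfolding D_def using fN vN by (subst card_Un_disjoint) (auto simp: card_cartesian_product)
  have DR: "D \<subseteq> R" unfolding D_def using d(3) by auto
  have "delete_vertex v R = R - D" unfolding delete_vertex_def D_def using d(3) by auto
  then show ?thesis using cD card_mono[OF d(2) DR] card_Diff_subset[of D R] DR d(2) finite_subset
    by (metis le_add_diff_inverse2)
qed

lemma delete_vertex_sgraph: "sgraph V R \<Longrightarrow> sgraph (V - {v}) (delete_vertex v R)"
  unfolding sgraph_def delete_vertex_def sym_def irrefl_def by auto

text \<open>A labelling of the smaller graph extends to \<open>v\<close> by any label without
  conflict at its neighbours, and both sides still occur since they already occur away from
  \<open>v\<close>.\<close>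

lemma delete_vertex_uncut:
  assumes G: "uncut V R"
    and N: "\<And>f. labelling R f \<or> labelling (delete_vertex v R) f \<Longrightarrow> \<exists>l. \<forall>y. (v, y) \<in> R \<longrightarrow> \<not> conflict l (f y)"
  shows "uncut (V - {v}) (delete_vertex v R)"
proof -
  have S: "sgraph V R" using G by (simp add: uncut_def)
  note d = sgraphD[OF S]
  have False if f: "labelling (delete_vertex v R) f"
    and LR: "Lft \<in> f ` (V - {v})" "Rgt \<in> f ` (V - {v})" for f
  proof -
    obtain l where l: "\<And>y. (v, y) \<in> R \<Longrightarrow> \<not> conflict l (f y)" using N f by blast
    let ?g = "f(v := l)"
    have "labelling R ?g"
      unfolding labelling_def
    proof (intro allI impI)
      fix u w assume uw: "(u, w) \<in> R"
      show "\<not> conflict (?g u) (?g w)"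
      proof (cases "u = v \<or> w = v")
        case True
        moreover have "u \<noteq> w" using uw d(4) by blast
        ultimately show ?thesis
          using l[of u] l[of w] uw d(3)[OF uw] conflict_sym[of "f u" l] by (auto split: if_splits)
      next
        case False
        then have "(u, w) \<in> delete_vertex v R" using uw by (auto simp: delete_vertex_def)
        then show ?thesis using f False unfolding labelling_def by simp
      qed
    qed
    moreover have "Lft \<in> ?g ` V" "Rgt \<in> ?g ` V" using LR by force+
    ultimately show False using G unfolding uncut_def by blast
  qed
  then show ?thesis using delete_vertex_sgraph[OF S] unfolding uncut_def by blast
qed

text \<open>Each label conflicts with exactly one label, so a vertex can fail to extend a labelling only if
  its neighbours carry all card_V_ge_4 labels.\<close>

lemma free_label:
  assumes "\<not> (\<forall>l. \<exists>y\<in>N. f y = l)"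
  shows "\<exists>l. \<forall>y\<in>N. \<not> conflict l (f y)"
proof -
  obtain l where l: "\<forall>y\<in>N. f y \<noteq> l" using assms by blast
  \<comment> \<open>Every label has a conflicting partner. The partner of the missing label
    \<open>l\<close> conflicts with nothing else, hence with no label that occurs.\<close>
  have "conflict (case l of Lft \<Rightarrow> Rgt | Rgt \<Rightarrow> Lft | Zero \<Rightarrow> Zero | One \<Rightarrow> One) l"
    by (cases l) auto
  then obtain l' where "conflict l' l" by blast
  then show ?thesis using l conflict_unique by metis
qed

lemma delete_vertex_uncut_deg_3:
  assumes G: "uncut V R" and N: "card (R `` {v}) \<le> 3"
  shows "uncut (V - {v}) (delete_vertex v R)"
proof (rule delete_vertex_uncut[OF G])
  fix f :: "'a \<Rightarrow> label"
  have S: "sgraph V R" using G by (simp add: uncut_def)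
  have fin: "finite (R `` {v})" using sgraphD(2)[OF S] finite_Image by blast
  have "\<not> (\<forall>l. \<exists>y\<in>R `` {v}. f y = l)"
  proof
    assume "\<forall>l. \<exists>y\<in>R `` {v}. f y = l"
    then have "(UNIV :: label set) \<subseteq> f ` (R `` {v})" by (metis imageI subsetI)
    then have "card (UNIV :: label set) \<le> card (R `` {v})"
      using fin by (meson card_image_le card_mono finite_imageI order_trans)
    then show False using N by (simp add: UNIV_label)
  qed
  then show "\<exists>l. \<forall>y. (v, y) \<in> R \<longrightarrow> \<not> conflict l (f y)" using free_label[of "R `` {v}" f] by blast
qed

text \<open>\<open>Lft\<close> and \<open>Rgt\<close> cannot both occur in a clique, so the
  neighbours miss a label.\<close>

lemma delete_vertex_uncut_clique:
  assumes G: "uncut V R"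
    and N: "\<And>x y. (v, x) \<in> R \<Longrightarrow> (v, y) \<in> R \<Longrightarrow> x \<noteq> y \<Longrightarrow> (x, y) \<in> R"
  shows "uncut (V - {v}) (delete_vertex v R)"
proof (rule delete_vertex_uncut[OF G])
  fix f assume f: "labelling R f \<or> labelling (delete_vertex v R) f"
  have S: "sgraph V R" using G by (simp add: uncut_def)
  have "\<not> (\<forall>l. \<exists>y\<in>R `` {v}. f y = l)"
  proof
    assume "\<forall>l. \<exists>y\<in>R `` {v}. f y = l"
    then obtain x y where xy: "(v, x) \<in> R" "f x = Lft" "(v, y) \<in> R" "f y = Rgt" by blast
    then have "x \<noteq> y" by auto
    then have "(x, y) \<in> R" using N xy by blast
    moreover have "x \<noteq> v" "y \<noteq> v" using xy sgraphD(4)[OF S] by auto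
    ultimately have "(x, y) \<in> delete_vertex v R" "(x, y) \<in> R" by (auto simp: delete_vertex_def)
    then show False using f xy unfolding labelling_def by force
  qed
  then show "\<exists>l. \<forall>y. (v, y) \<in> R \<longrightarrow> \<not> conflict l (f y)" using free_label[of "R `` {v}" f] by blast
qed

text \<open>A vertex outside all three sets would be on the side \<open>Rgt\<close>, opposite to
  \<open>S\<close>. The sets may overlap; the order of the tests in the labelling decides.\<close>

lemma cutI:
  assumes G: "uncut V R" and S: "S \<subseteq> V" "S \<noteq> {}"
    and N: "\<And>x y. x \<in> S \<Longrightarrow> (x, y) \<in> R \<Longrightarrow> y \<in> S \<union> P \<union> Q"
    and P: "\<And>x y. x \<in> P \<Longrightarrow> y \<in> P \<Longrightarrow> (x, y) \<notin> R"
    and Q: "\<And>x y. x \<in> Q \<Longrightarrow> y \<in> Q \<Longrightarrow> (x, y) \<notin> R"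
  shows "V \<subseteq> S \<union> P \<union> Q"
proof (rule ccontr)
  assume "\<not> ?thesis"
  then obtain r where r: "r \<in> V" "r \<notin> S" "r \<notin> P" "r \<notin> Q" by auto
  let ?f = "\<lambda>x. if x \<in> S then Lft else if x \<in> P then Zero else if x \<in> Q then One else Rgt"
  have sy: "sym R" using G by (simp add: uncut_def sgraph_def)
  have "labelling R ?f"
    unfolding labelling_def
  proof (intro allI impI)
    fix x y assume "(x, y) \<in> R"
    then have "(x, y) \<in> R" "(y, x) \<in> R" using sy[THEN symD] by auto
    then show "\<not> conflict (?f x) (?f y)"
      using N[of x y] N[of y x] P[of x y] Q[of x y] by auto
  qed
  moreover have "Lft \<in> ?f ` V" using S by force
  moreover have "Rgt \<in> ?f ` V" using r by force
  ultimately show False using G unfolding uncut_def by blast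
qed

lemma card_degree_sum:
  assumes "sgraph V R"
  shows "card R = (\<Sum>v\<in>V. card (R `` {v}))"
proof -
  note d = sgraphD[OF assms]
  have "R = (SIGMA v:V. R `` {v})" using d(5) by auto
  moreover have "card (SIGMA v:V. R `` {v}) = (\<Sum>v\<in>V. card (R `` {v}))"
    using d(1,2) by (intro card_SigmaI) (auto intro: finite_Image)
  ultimately show ?thesis by simp
qed

lemma identify_Image:
  assumes "u \<noteq> x" "u \<noteq> y"
  shows "identify x y R `` {u} = (\<lambda>z. if z = y then x else z) ` (R `` {u})"
proof (intro equalityI subsetI)
  fix w assume "w \<in> identify x y R `` {u}"
  then show "w \<in> (\<lambda>z. if z = y then x else z) ` (R `` {u})"
    using assms by (auto simp: identify_iff split: if_splits)
next
  fix w assume "w \<in> (\<lambda>z. if z = y then x else z) ` (R `` {u})"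
  then obtain z where "(u, z) \<in> R" "w = (if z = y then x else z)" by auto
  then show "w \<in> identify x y R `` {u}"
    using assms identifyI identifyI_right by (cases "z = y") fastforce+
qed

lemma delete_vertex_Image: "u \<noteq> v \<Longrightarrow> delete_vertex v R `` {u} = R `` {u} - {v}"
  by (auto simp: delete_vertex_def)

lemma card_le_2_subset_pair:
  assumes "finite A" "card A \<le> 2" shows "\<exists>x y. A \<subseteq> {x, y}"
proof -
  consider "card A = 0" | "card A = 1" | "card A = 2" using assms(2) by linarith
  then show ?thesis
    by cases (use assms in \<open>auto simp: card_1_singleton_iff card_2_iff\<close>)
qed

text \<open>
  The variables are the possible edges on vertices $a,\dots,f$, apart from the edge $ab$. In the application
  $\{c,d\}$ and $\{e,f\}$ are the private neighbours of two adjacent vertices with common neighbours $a$, $b$, and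
  the last eight assumptions exclude the configuration of \<open>no_butterfly\<close>.
\<close>

lemma two_colouring_six:
  fixes ca cb da db ea eb fa fb cd ef ce cf de df :: bool
  assumes "\<not> (ca \<and> cb)" "\<not> (ca \<and> ce)" "\<not> (ca \<and> cf)" "\<not> (cb \<and> ce)" "\<not> (cb \<and> cf)" "\<not> (ce \<and> cf)"
    and "\<not> (da \<and> db)" "\<not> (da \<and> de)" "\<not> (da \<and> df)" "\<not> (db \<and> de)" "\<not> (db \<and> df)" "\<not> (de \<and> df)"
    and "\<not> (ea \<and> eb)" "\<not> (ea \<and> ce)" "\<not> (ea \<and> de)" "\<not> (eb \<and> ce)" "\<not> (eb \<and> de)" "\<not> (ce \<and> de)"
    and "\<not> (fa \<and> fb)" "\<not> (fa \<and> cf)" "\<not> (fa \<and> df)" "\<not> (fb \<and> cf)" "\<not> (fb \<and> df)" "\<not> (cf \<and> df)"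
    and "\<not> (cd \<and> ca \<and> (da \<or> de \<or> df))" "\<not> (cd \<and> cb \<and> (db \<or> de \<or> df))"
    and "\<not> (cd \<and> da \<and> (ca \<or> ce \<or> cf))" "\<not> (cd \<and> db \<and> (cb \<or> ce \<or> cf))"
    and "\<not> (ef \<and> ea \<and> (fa \<or> cf \<or> df))" "\<not> (ef \<and> eb \<and> (fb \<or> cf \<or> df))"
    and "\<not> (ef \<and> fa \<and> (ea \<or> ce \<or> de))" "\<not> (ef \<and> fb \<and> (eb \<or> ce \<or> de))"
  shows "\<exists>C D E F. (ca \<longrightarrow> \<not> C) \<and> (cb \<longrightarrow> C) \<and> (da \<longrightarrow> \<not> D) \<and> (db \<longrightarrow> D) \<and> (ea \<longrightarrow> \<not> E) \<and> (eb \<longrightarrow> E)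
    \<and> (fa \<longrightarrow> \<not> F) \<and> (fb \<longrightarrow> F) \<and> (cd \<longrightarrow> C \<noteq> D) \<and> (ef \<longrightarrow> E \<noteq> F) \<and> (ce \<longrightarrow> C \<noteq> E) \<and> (cf \<longrightarrow> C \<noteq> F)
    \<and> (de \<longrightarrow> D \<noteq> E) \<and> (df \<longrightarrow> D \<noteq> F)"
  \<comment> \<open>The value true stands for the class of a, false for that of b, which are
    opposite from the start. Expanding the quantifiers leaves a propositional problem over sixteen
    colourings.\<close>
  using assms unfolding ex_bool_eq by argo

lemma nonempty_card_le_2:
  assumes "finite A" "A \<noteq> {}" "card A \<le> 2"
  shows "\<exists>x y. A = {x, y}"
proof -
  have "card A \<noteq> 0" using assms by simp
  then consider "card A = 1" | "card A = 2" using assms(3) by linarith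
  then show ?thesis
    by cases (auto simp: card_1_singleton_iff card_2_iff)
qed

lemma other_of_card_2:
  assumes "card A = 2" "x \<in> A" obtains y where "A = {x, y}" "x \<noteq> y"
  using assms unfolding card_2_iff by auto

section \<open>Reducible configurations\<close>

text \<open>The coefficients 160 and 268 are 2 * 80 and 2 * 134, because \<open>card R\<close>
  counts every edge twice. Comparing only with graphs over the same type suffices, as reductions
  only discard vertices.\<close>

locale minimal_counterexample =
  fixes V :: "'a set" and R :: "'a rel"
  assumes uncut: "uncut V R"
    and card_V_ge_4: "4 \<le> card V"
    and sparse: "31 * card R + 268 < 160 * card V"
    and minimal: "\<And>V' R'. uncut V' R' \<Longrightarrow> 4 \<le> card V' \<Longrightarrow> card V' < card V \<Longrightarrow>
      160 * card V' \<le> 31 * card (R' :: 'a rel) + 268"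
begin

lemma sg: "sgraph V R"
  using uncut by (simp add: uncut_def)

abbreviation adj :: "'a \<Rightarrow> 'a \<Rightarrow> bool" where
  "adj x y \<equiv> (x, y) \<in> R"

abbreviation nbs :: "'a \<Rightarrow> 'a set" where
  "nbs x \<equiv> R `` {x}"

abbreviation deg :: "'a \<Rightarrow> nat" where
  "deg x \<equiv> card (nbs x)"

lemma finV [simp]: "finite V" and finN [simp]: "finite (nbs x)"
  using sgraphD(1,2)[OF sg] by (auto intro: finite_Image)

lemma adj_sym: "adj x y \<Longrightarrow> adj y x"
  using sgraphD(3)[OF sg] .

lemma adj_comm: "adj x y \<longleftrightarrow> adj y x"
  using adj_sym by blast

lemma adj_irrefl [simp]: "\<not> adj x x"
  using sgraphD(4)[OF sg] .

lemma adj_neq: "adj x y \<Longrightarrow> x \<noteq> y"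
  by auto

lemma adj_V: "adj x y \<Longrightarrow> x \<in> V" "adj x y \<Longrightarrow> y \<in> V"
  using sgraphD(5,6)[OF sg] by auto

text \<open>Losing \<open>e\<close> edges with \<open>k\<close> vertices at this rate keeps the
  smaller graph below the edge bound, and \<open>k + 4 \<le> card V\<close> keeps it within the
  range of minimality.\<close>

lemma reduction:
  assumes "uncut V' (R' :: 'a rel)" "card V' + k = card V" "0 < k" "k + 4 \<le> card V"
    "card R' + 2 * e \<le> card R" "80 * k \<le> 31 * e"
  shows False
  using minimal[OF assms(1)] assms(2-) sparse by linarith

text \<open>In applications \<open>W\<close> is an explicit list of vertices, whose length bounds
  its cardinality even if entries coincide.\<close>

lemma cut:
  assumes "S \<subseteq> V" "S \<noteq> {}" "\<And>x y. x \<in> S \<Longrightarrow> adj x y \<Longrightarrow> y \<in> S \<union> P \<union> Q"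
    "\<And>x y. x \<in> P \<Longrightarrow> y \<in> P \<Longrightarrow> \<not> adj x y" "\<And>x y. x \<in> Q \<Longrightarrow> y \<in> Q \<Longrightarrow> \<not> adj x y"
    "S \<union> P \<union> Q \<subseteq> W" "finite W" "card W < card V"
  shows False
proof -
  have "V \<subseteq> S \<union> P \<union> Q" by (rule cutI[OF uncut]) (use assms in auto)
  then have "V \<subseteq> W" using assms(6) by blast
  then show False using card_mono[OF assms(7)] assms(8) by (meson leD)
qed

section \<open>Minimum degree and order\<close>

lemma deg_ge_3:
  assumes v: "v \<in> V" shows "3 \<le> deg v"
proof (rule ccontr)
  assume "\<not> ?thesis"
  then obtain x y where xy: "nbs v \<subseteq> {x, y}" using card_le_2_subset_pair[of "nbs v"] by auto
  show False
  proof (rule cut[of "{v}" "{x}" "{y}" "{v, x, y}"])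
    have "card {v, x, y} \<le> 3" by (simp add: card_insert_le_m1)
    then show "card {v, x, y} < card V" using card_V_ge_4 by linarith
  qed (use v xy in auto)
qed

lemma card_R_ge:
  assumes "\<And>v. v \<in> V \<Longrightarrow> k \<le> deg v" shows "k * card V \<le> card R"
  using card_degree_sum[OF sg] sum_bounded_below[of V k deg] assms by (simp add: mult.commute)

text \<open>Four vertices of degree at least 3 give 12 arcs, and 31 * 12 + 268 = 160 * 4
  exactly.\<close>

lemma card_V_ge_5: "5 \<le> card V"
proof (rule ccontr)
  assume "\<not> ?thesis"
  then have "card V = 4" using card_V_ge_4 by linarith
  then show False using card_R_ge[of 3] deg_ge_3 sparse by simp
qed

lemma deg_ge_4:
  assumes v: "v \<in> V" shows "4 \<le> deg v"
proof (rule ccontr)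
  assume "\<not> ?thesis"
  then have 3: "deg v = 3" using deg_ge_3[OF v] by linarith
  show False
    using reduction[OF delete_vertex_uncut_deg_3[OF uncut, of v], of 1 3] delete_vertex_card[OF sg, of v] v 3 card_V_ge_5
    by (simp add: card_Diff_singleton)
qed

text \<open>Degrees at least 4 turn the edge bound into 268 < 36 n. Below, one vertex of degree 5
  raises the left side to 299, three raise it to 361.\<close>

lemma card_V_ge_8: "8 \<le> card V"
proof -
  have "4 * card V \<le> card R" using card_R_ge deg_ge_4 by blast
  then show ?thesis using sparse by linarith
qed

lemma card_R_ge_large:
  assumes "L \<subseteq> V" "\<And>v. v \<in> L \<Longrightarrow> 5 \<le> deg v" shows "4 * card V + card L \<le> card R"
proof -
  have fin: "finite L" by (rule finite_subset[OF assms(1) finV])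
  have "(\<Sum>v\<in>V. 4 + (if v \<in> L then 1 else 0)) \<le> (\<Sum>v\<in>V. deg v)"
    using assms deg_ge_4 by (intro sum_mono) auto
  also have "(\<Sum>v\<in>V. 4 + (if v \<in> L then 1 else 0)) = 4 * card V + card L"
    using assms(1) fin by (simp add: sum.distrib sum.If_cases Int_absorb1)
  finally show ?thesis using card_degree_sum[OF sg] by simp
qed

lemma card_V_ge_9:
  assumes "v \<in> V" "5 \<le> deg v" shows "9 \<le> card V"
  using card_R_ge_large[of "{v}"] assms sparse by simp

lemma card_V_ge_10:
  assumes "L \<subseteq> V" "\<And>v. v \<in> L \<Longrightarrow> 5 \<le> deg v" "card L = 3" shows "10 \<le> card V"
  using card_R_ge_large[of L] assms sparse by simp

text \<open>Identifying two nonadjacent vertices never creates a bipartite cut, and it destroys one edge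
  for every common neighbour.\<close>

lemma common_3:
  assumes "adj x p" "adj x q" "adj x r" "adj y p" "adj y q" "adj y r"
    and "p \<noteq> q" "p \<noteq> r" "q \<noteq> r" "x \<noteq> y"
  shows "adj x y"
proof (rule ccontr)
  assume n: "\<not> adj x y"
  have V: "x \<in> V" "y \<in> V" using assms adj_V by blast+
  have C: "{p, q, r} \<subseteq> nbs x \<inter> nbs y" using assms by auto
  \<comment> \<open>Three lost edges suffice since 31 * 3 = 93 >= 80; two would give only
    62.\<close>
  show False
    using reduction[OF identify_uncut[OF uncut V assms(10) n], of 1 3]
      identify_card[OF sg assms(10) C] V assms(7-9) card_V_ge_5
    by (simp add: card_Diff_singleton)
qed

lemma no_clique_nbs:
  assumes v: "v \<in> V" and N: "\<And>x y. adj v x \<Longrightarrow> adj v y \<Longrightarrow> x \<noteq> y \<Longrightarrow> adj x y"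
  shows False
proof -
  have "uncut (V - {v}) (delete_vertex v R)" using delete_vertex_uncut_clique[OF uncut] N by blast
  then show False
    using reduction[of "V - {v}" "delete_vertex v R" 1 "deg v"] delete_vertex_card[OF sg, of v] v deg_ge_4[OF v] card_V_ge_5
    by (simp add: card_Diff_singleton)
qed

text \<open>Identifying $c$ with $b$ and $d$ with $v$ and deleting $u$ loses 3 vertices and 8 edges.\<close>

lemma no_butterfly:
  assumes N: "nbs u = {v, a, b, c, d}" "deg u = 5"
    and e: "adj b v" "adj c d" "adj a b" "adj a c" "\<not> adj b c" "\<not> adj v d"
    and z: "adj z v" "adj z d" "z \<noteq> u" "z \<noteq> b" "z \<noteq> c"
  shows False
proof -
  have dist: "distinct [v, a, b, c, d]"
    using N by (intro card_distinct) simp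
  have u: "adj u v" "adj u a" "adj u b" "adj u c" "adj u d" using N by auto
  have uV: "u \<in> V" "b \<in> V" "c \<in> V" "d \<in> V" "v \<in> V" using u adj_V by blast+
  have nu: "u \<noteq> v" "u \<noteq> a" "u \<noteq> b" "u \<noteq> c" "u \<noteq> d" using u by auto
  define R1 where "R1 = identify b c R"
  define R2 where "R2 = identify v d R1"
  have G1: "uncut (V - {c}) R1"
    unfolding R1_def using identify_uncut[OF uncut _ _ _ e(5)] uV dist by simp
  have C1: "card R1 + 2 * 2 \<le> card R"
    unfolding R1_def using identify_card[OF sg, of b c "{a, u}"] u e dist nu adj_comm by auto
  have S1: "sgraph (V - {c}) R1" using G1 by (simp add: uncut_def)
  have "(v, d) \<notin> R1"
    unfolding R1_def identify_iff using e(6) dist by (auto split: if_splits)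
  then have G2: "uncut (V - {c} - {d}) R2"
    unfolding R2_def by (intro identify_uncut[OF G1]) (use uV dist in auto)
  have "(v, u) \<in> R1" "(d, u) \<in> R1" "(v, b) \<in> R1" "(v, z) \<in> R1" "(d, z) \<in> R1"
    unfolding R1_def by (rule identifyI; use u e z dist nu adj_comm in auto)+
  \<comment> \<open>This is the renamed arc from \<open>d\<close> to \<open>c\<close>: the first
    identification supplies a common neighbour for the second.\<close>
  moreover have "(d, b) \<in> R1"
    unfolding R1_def by (rule identifyI_right) (use e dist adj_comm in auto)
  ultimately have "card R2 + 2 * card {u, b, z} \<le> card R1"
    unfolding R2_def using dist by (intro identify_card[OF S1]) auto
  then have C2: "card R2 + 2 * 3 \<le> card R1" using nu z by simp
  have "R1 `` {u} = {v, a, b, d}"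
    unfolding R1_def using identify_Image[of u b c R] nu dist N by auto
  then have N2: "R2 `` {u} = {v, a, b}"
    unfolding R2_def using identify_Image[of u v d R1] nu dist by auto
  then have d3: "card (R2 `` {u}) = 3" using dist by simp
  have G3: "uncut (V - {c} - {d} - {u}) (delete_vertex u R2)"
    using delete_vertex_uncut_deg_3[OF G2, of u] d3 by simp
  have "card (V - {c} - {d} - {u}) + 3 = card V"
    using uV nu dist card_V_ge_9[of u] N by (auto simp: card_Diff_singleton_if)
  moreover have "sgraph (V - {c} - {d}) R2" using G2 by (simp add: uncut_def)
  \<comment> \<open>The losses are 2 + 3 + 3 = 8 edges, and 31 * 8 = 248 >= 240 = 80 * 3.\<close>
  ultimately show False
    using reduction[OF G3, of 3 8] delete_vertex_card[of "V - {c} - {d}" R2 u] d3 C1 C2 card_V_ge_9[of u] N uV by simp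
qed

section \<open>Bipartite vertex sets and neighbourhoods of low edges\<close>

definition bip :: "'a set \<Rightarrow> bool" where
  "bip W \<longleftrightarrow> (\<exists>P Q. W = P \<union> Q \<and> (\<forall>x\<in>P. \<forall>y\<in>P. \<not> adj x y) \<and> (\<forall>x\<in>Q. \<forall>y\<in>Q. \<not> adj x y))"

lemma bip_cut:
  assumes "bip W" "S \<subseteq> V" "S \<noteq> {}" "\<And>x. x \<in> S \<Longrightarrow> nbs x \<subseteq> S \<union> W"
    "finite (S \<union> W)" "card (S \<union> W) < card V"
  shows False
proof -
  obtain P Q where W: "W = P \<union> Q" and PQ: "\<forall>x\<in>P. \<forall>y\<in>P. \<not> adj x y" "\<forall>x\<in>Q. \<forall>y\<in>Q. \<not> adj x y"
    using assms(1) unfolding bip_def by blast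
  show False
  proof (rule cut[of S P Q "S \<union> W"])
    show "y \<in> S \<union> P \<union> Q" if "x \<in> S" "adj x y" for x y
      using assms(4)[OF that(1)] that(2) W by blast
    show "\<not> adj x y" if "x \<in> P" "y \<in> P" for x y using PQ(1) that by blast
    show "\<not> adj x y" if "x \<in> Q" "y \<in> Q" for x y using PQ(2) that by blast
    show "S \<union> P \<union> Q \<subseteq> S \<union> W" using W by blast
  qed (fact assms(2,3,5,6))+
qed

lemma bipI:
  "W = P \<union> Q \<Longrightarrow> (\<And>x y. x \<in> P \<Longrightarrow> y \<in> P \<Longrightarrow> \<not> adj x y) \<Longrightarrow>
    (\<And>x y. x \<in> Q \<Longrightarrow> y \<in> Q \<Longrightarrow> \<not> adj x y) \<Longrightarrow> bip W"
  unfolding bip_def by (intro exI[of _ P] exI[of _ Q]) simp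

lemma bipE:
  assumes "bip W"
  obtains P Q where "W = P \<union> Q" "\<And>x y. x \<in> P \<Longrightarrow> y \<in> P \<Longrightarrow> \<not> adj x y"
    "\<And>x y. x \<in> Q \<Longrightarrow> y \<in> Q \<Longrightarrow> \<not> adj x y"
proof -
  obtain P Q where "W = P \<union> Q" "\<forall>x\<in>P. \<forall>y\<in>P. \<not> adj x y" "\<forall>x\<in>Q. \<forall>y\<in>Q. \<not> adj x y"
    using assms unfolding bip_def by (elim exE conjE)
  then show thesis by (intro that[of P Q]) simp_all
qed

lemma bip_insert:
  assumes "bip W" and c: "\<And>x y. x \<in> W \<Longrightarrow> y \<in> W \<Longrightarrow> adj c x \<Longrightarrow> adj c y \<Longrightarrow> x = y"
  shows "bip (insert c W)"
proof -
  obtain P Q where W: "W = P \<union> Q" and P: "\<And>x y. x \<in> P \<Longrightarrow> y \<in> P \<Longrightarrow> \<not> adj x y"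
    and Q: "\<And>x y. x \<in> Q \<Longrightarrow> y \<in> Q \<Longrightarrow> \<not> adj x y"
    using bipE[OF assms(1)] by metis
  show ?thesis
  proof (cases "\<exists>x\<in>P. adj c x")
    case False
    show ?thesis
    proof (rule bipI)
      show "insert c W = insert c P \<union> Q" using W by blast
      show "\<not> adj x y" if "x \<in> insert c P" "y \<in> insert c P" for x y
        using that P[of x y] False adj_sym[of x y] by (cases "x = c"; cases "y = c") auto
    qed (fact Q)
  next
    case True
    then obtain z where z: "z \<in> P" "adj c z" by blast
    \<comment> \<open>The two classes may overlap, so \<open>z\<close> must leave \<open>Q\<close>
      before \<open>c\<close> can join it.\<close>
    then have n: "\<not> adj c y" if "y \<in> Q - {z}" for y using c[of z y] W that by blast
    show ?thesis
    proof (rule bipI)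
      show "insert c W = P \<union> insert c (Q - {z})" using W z by blast
      show "\<not> adj x y" if "x \<in> insert c (Q - {z})" "y \<in> insert c (Q - {z})" for x y
        using that Q[of x y] n[of x] n[of y] adj_sym[of x y] by (cases "x = c"; cases "y = c") auto
    qed (fact P)
  qed
qed

definition triangle_free :: "'a set \<Rightarrow> bool" where
  "triangle_free W \<longleftrightarrow> \<not> (\<exists>x\<in>W. \<exists>y\<in>W. \<exists>z\<in>W. adj x y \<and> adj y z \<and> adj x z)"

text \<open>The neighbours of \<open>x\<close> are independent for lack of triangles. The
  non-neighbours include \<open>x\<close> itself, hence at most one further vertex.\<close>

lemma bip_if_few_nonneighbours:
  assumes "triangle_free W" "finite W" "x \<in> W" "card (W - nbs x) \<le> 2"
  shows "bip W"
proof -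
  have "\<not> adj y z" if "y \<in> W - nbs x" "z \<in> W - nbs x" for y z
  proof
    assume yz: "adj y z"
    then have "y \<noteq> x" "z \<noteq> x" "y \<noteq> z" using that adj_sym by auto
    then have "card {x, y, z} = 3" by simp
    moreover have "{x, y, z} \<subseteq> W - nbs x" using that assms(3) by auto
    ultimately show False using assms(2,4) card_mono[of "W - nbs x" "{x, y, z}"] by simp
  qed
  moreover have "\<not> adj y z" if "y \<in> W \<inter> nbs x" "z \<in> W \<inter> nbs x" for y z
    using assms(1,3) that unfolding triangle_free_def by blast
  moreover have "W = (W \<inter> nbs x) \<union> (W - nbs x)" by blast
  ultimately show ?thesis using bipI[of W "W \<inter> nbs x" "W - nbs x"] by metis
qed

lemma bip_leaf:
  assumes "finite W" "x \<in> W" "card (W \<inter> nbs x) \<le> 1" "bip (W - {x})"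
  shows "bip W"
proof -
  have "y = z" if "y \<in> W - {x}" "z \<in> W - {x}" "adj x y" "adj x z" for y z
    using assms(1,3) that card_le_Suc0_iff_eq[of "W \<inter> nbs x"] by auto
  then have "bip (insert x (W - {x}))" using bip_insert[OF assms(4)] by blast
  then show ?thesis using assms(2) by (simp add: insert_absorb)
qed

text \<open>Strip vertices with at most one neighbour; if none exists, a vertex with two neighbours
  among at most four vertices has at most two non-neighbours.\<close>

lemma bip_four:
  assumes "triangle_free W" "finite W" "card W \<le> 4" shows "bip W"
  using assms
proof (induction "card W" arbitrary: W rule: less_induct)
  case less
  show ?case
  proof (cases "\<exists>x\<in>W. card (W \<inter> nbs x) \<le> 1")
    case True
    then obtain x where x: "x \<in> W" "card (W \<inter> nbs x) \<le> 1" by blast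
    have "card (W - {x}) < card W" using less.prems x by (intro psubset_card_mono) auto
    moreover have "triangle_free (W - {x})" using less.prems(1) unfolding triangle_free_def by blast
    ultimately have "bip (W - {x})" using less.hyps less.prems by simp
    then show ?thesis using bip_leaf less.prems x by blast
  next
    case False
    show ?thesis
    proof (cases "W = {}")
      case True
      then show ?thesis unfolding bip_def by blast
    next
      case ne: False
      then obtain x where x: "x \<in> W" by blast
      then have "2 \<le> card (W \<inter> nbs x)" using False by force
      then have "card (W - nbs x) \<le> 2"
        using less.prems card_Diff_subset_Int[of W "nbs x"] by simp
      then show ?thesis using bip_if_few_nonneighbours less.prems x by blast
    qed
  qed
qed

text \<open>The missing non-adjacencies of \<open>no_butterfly\<close> come for free:
  \<open>c\<close> and \<open>d\<close> are not common neighbours, and if \<open>b\<close> were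
  adjacent to \<open>c\<close>, then \<open>c\<close> and \<open>v\<close> would share
  \<open>u\<close>, \<open>a\<close>, \<open>b\<close> and be adjacent by
  \<open>common_3\<close>.\<close>

lemma no_butterfly_at_edge:
  assumes uv: "adj u v" and M: "nbs u \<inter> nbs v = {a, b}" and ab: "adj a b"
    and N: "nbs u = {v, a, b, c, d}" "deg u = 5"
    and e: "adj c d" "adj a c" and z: "adj v z" "z \<noteq> u" "z \<noteq> b" "adj d z"
  shows False
proof -
  have dist: "distinct [v, a, b, c, d]" using N by (intro card_distinct) simp
  have uN: "adj u x \<longleftrightarrow> x \<in> {v, a, b, c, d}" for x using N(1) by (metis Image_singleton_iff)
  have uM: "adj u x \<and> adj v x \<longleftrightarrow> x \<in> {a, b}" for x using M by (metis Image_singleton_iff IntD1 IntD2 IntI)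
  have cd: "\<not> adj v c" "\<not> adj v d" using uM[of c] uM[of d] uN[of c] uN[of d] dist by auto
  have au: "adj u a" "adj u b" "adj u c" "adj v a" "adj v b" using uM[of a] uM[of b] uN[of c] by auto
  have bc: "\<not> adj b c"
  proof
    assume "adj b c"
    then have "adj c v"
      using common_3[of c u a b v] adj_sym[of u c] adj_sym[of a c] adj_sym[of b c] adj_sym[of u v] adj_neq[OF au(1)] adj_neq[OF au(2)]
        au e(2) uv dist cd by auto
    then show False using adj_sym[of c v] cd by simp
  qed
  have "z \<noteq> c" using z cd by blast
  then show False
    using no_butterfly[OF N adj_sym[OF au(5)] e(1) ab e(2) bc cd(2) adj_sym[OF z(1)] adj_sym[OF z(4)] z(2,3)]
    by blast
qed

text \<open>The assumptions \<open>cd\<close> and \<open>ef\<close> exclude butterflies: an edge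
  \<open>x y\<close> within a private pair, \<open>x\<close> adjacent to \<open>p\<close>, and
  \<open>y\<close> adjacent to \<open>p\<close> (a triangle) or to the other pair.\<close>

lemma bip_pair_nbs:
  assumes ab: "a \<noteq> b"
    and C: "\<And>x y. x \<in> {a, b, e, f} \<Longrightarrow> y \<in> {a, b, e, f} \<Longrightarrow> x \<noteq> y \<Longrightarrow>
      \<not> (adj c x \<and> adj c y) \<and> \<not> (adj d x \<and> adj d y)"
    and E: "\<And>x y. x \<in> {a, b, c, d} \<Longrightarrow> y \<in> {a, b, c, d} \<Longrightarrow> x \<noteq> y \<Longrightarrow>
      \<not> (adj e x \<and> adj e y) \<and> \<not> (adj f x \<and> adj f y)"
    and dist: "{a, b} \<inter> {c, d} = {}" "{a, b} \<inter> {e, f} = {}" "{c, d} \<inter> {e, f} = {}"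
    and cd: "\<And>x y z p. adj x y \<Longrightarrow> {x, y} = {c, d} \<Longrightarrow> p \<in> {a, b} \<Longrightarrow> adj p x \<Longrightarrow> z \<in> {p, e, f} \<Longrightarrow> \<not> adj y z"
    and ef: "\<And>x y z p. adj x y \<Longrightarrow> {x, y} = {e, f} \<Longrightarrow> p \<in> {a, b} \<Longrightarrow> adj p x \<Longrightarrow> z \<in> {p, c, d} \<Longrightarrow> \<not> adj y z"
  shows "bip {a, b, c, d, e, f}"
proof -
  \<comment> \<open>A pair may consist of one repeated vertex. The guards switch off the variables
    of the second copy, whose colour is then ignored.\<close>
  define da db de ea eb fa fb ce cf df where
    defs: "da = (c \<noteq> d \<and> adj d a)" "db = (c \<noteq> d \<and> adj d b)" "de = (c \<noteq> d \<and> adj d e)"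
    "ea = adj e a" "eb = adj e b" "fa = (e \<noteq> f \<and> adj f a)" "fb = (e \<noteq> f \<and> adj f b)"
    "ce = adj c e" "cf = (e \<noteq> f \<and> adj c f)" "df = (c \<noteq> d \<and> e \<noteq> f \<and> adj d f)"
  have ne: "c \<noteq> a" "c \<noteq> b" "c \<noteq> e" "c \<noteq> f" "d \<noteq> a" "d \<noteq> b" "d \<noteq> e" "d \<noteq> f" "e \<noteq> a" "e \<noteq> b" "f \<noteq> a" "f \<noteq> b"
    using dist by auto
  have "\<exists>C D E F. (adj c a \<longrightarrow> \<not> C) \<and> (adj c b \<longrightarrow> C) \<and> (da \<longrightarrow> \<not> D) \<and> (db \<longrightarrow> D) \<and>
      (ea \<longrightarrow> \<not> E) \<and> (eb \<longrightarrow> E) \<and> (fa \<longrightarrow> \<not> F) \<and> (fb \<longrightarrow> F) \<and> (adj c d \<longrightarrow> C \<noteq> D) \<and>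
      (adj e f \<longrightarrow> E \<noteq> F) \<and> (ce \<longrightarrow> C \<noteq> E) \<and> (cf \<longrightarrow> C \<noteq> F) \<and> (de \<longrightarrow> D \<noteq> E) \<and> (df \<longrightarrow> D \<noteq> F)"
  proof (rule two_colouring_six)
    show "\<not> (adj c a \<and> adj c b)" using C[of a b] ab by simp
    show "\<not> (adj c a \<and> ce)" using C[of a e] ne unfolding defs by simp
    show "\<not> (adj c a \<and> cf)" using C[of a f] ne unfolding defs by simp
    show "\<not> (adj c b \<and> ce)" using C[of b e] ne unfolding defs by simp
    show "\<not> (adj c b \<and> cf)" using C[of b f] ne unfolding defs by simp
    show "\<not> (ce \<and> cf)" using C[of e f] unfolding defs by blast
    show "\<not> (da \<and> db)" using C[of a b] ab unfolding defs by simp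
    show "\<not> (da \<and> de)" using C[of a e] ne unfolding defs by simp
    show "\<not> (da \<and> df)" using C[of a f] ne unfolding defs by simp
    show "\<not> (db \<and> de)" using C[of b e] ne unfolding defs by simp
    show "\<not> (db \<and> df)" using C[of b f] ne unfolding defs by simp
    show "\<not> (de \<and> df)" using C[of e f] unfolding defs by blast
    show "\<not> (ea \<and> eb)" using E[of a b] ab unfolding defs by simp
    show "\<not> (ea \<and> ce)" using E[of a c] ne adj_comm[of c e] unfolding defs by auto
    show "\<not> (ea \<and> de)" using E[of a d] ne adj_comm[of d e] unfolding defs by auto
    show "\<not> (eb \<and> ce)" using E[of b c] ne adj_comm[of c e] unfolding defs by auto
    show "\<not> (eb \<and> de)" using E[of b d] ne adj_comm[of d e] unfolding defs by auto
    show "\<not> (ce \<and> de)" using E[of c d] adj_comm[of c e] adj_comm[of d e] unfolding defs by auto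
    show "\<not> (fa \<and> fb)" using E[of a b] ab unfolding defs by simp
    show "\<not> (fa \<and> cf)" using E[of a c] ne adj_comm[of c f] unfolding defs by auto
    show "\<not> (fa \<and> df)" using E[of a d] ne adj_comm[of d f] unfolding defs by auto
    show "\<not> (fb \<and> cf)" using E[of b c] ne adj_comm[of c f] unfolding defs by auto
    show "\<not> (fb \<and> df)" using E[of b d] ne adj_comm[of d f] unfolding defs by auto
    show "\<not> (cf \<and> df)" using E[of c d] adj_comm[of c f] adj_comm[of d f] unfolding defs by auto
    have cd1: "\<not> adj y z" if "x = c \<and> y = d \<or> x = d \<and> y = c" "adj c d" "p = a \<or> p = b" "adj x p" "z = p \<or> z = e \<or> z = f" for x y z p
      using cd[of x y p z] that adj_sym[of c d] adj_sym[of x p] by (auto simp: insert_commute)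
    have ef1: "\<not> adj y z" if "x = e \<and> y = f \<or> x = f \<and> y = e" "adj e f" "p = a \<or> p = b" "adj x p" "z = p \<or> z = c \<or> z = d" for x y z p
      using ef[of x y p z] that adj_sym[of e f] adj_sym[of x p] by (auto simp: insert_commute)
    show "\<not> (adj c d \<and> adj c a \<and> (da \<or> de \<or> df))"
      using cd1[of c d a a] cd1[of c d a e] cd1[of c d a f] unfolding defs by argo
    show "\<not> (adj c d \<and> adj c b \<and> (db \<or> de \<or> df))"
      using cd1[of c d b b] cd1[of c d b e] cd1[of c d b f] unfolding defs by argo
    show "\<not> (adj c d \<and> da \<and> (adj c a \<or> ce \<or> cf))"
      using cd1[of d c a a] cd1[of d c a e] cd1[of d c a f] unfolding defs by argo
    show "\<not> (adj c d \<and> db \<and> (adj c b \<or> ce \<or> cf))"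
      using cd1[of d c b b] cd1[of d c b e] cd1[of d c b f] unfolding defs by argo
    show "\<not> (adj e f \<and> ea \<and> (fa \<or> cf \<or> df))"
      using ef1[of e f a a] ef1[of e f a c] ef1[of e f a d] adj_sym[of c f] adj_sym[of d f] unfolding defs by argo
    show "\<not> (adj e f \<and> eb \<and> (fb \<or> cf \<or> df))"
      using ef1[of e f b b] ef1[of e f b c] ef1[of e f b d] adj_sym[of c f] adj_sym[of d f] unfolding defs by argo
    show "\<not> (adj e f \<and> fa \<and> (ea \<or> ce \<or> de))"
      using ef1[of f e a a] ef1[of f e a c] ef1[of f e a d] adj_sym[of c e] adj_sym[of d e] unfolding defs by argo
    show "\<not> (adj e f \<and> fb \<and> (eb \<or> ce \<or> de))"
      using ef1[of f e b b] ef1[of f e b c] ef1[of f e b d] adj_sym[of c e] adj_sym[of d e] unfolding defs by argo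
  qed
  then obtain C D E F where col: "adj c a \<longrightarrow> \<not> C" "adj c b \<longrightarrow> C" "da \<longrightarrow> \<not> D" "db \<longrightarrow> D"
      "ea \<longrightarrow> \<not> E" "eb \<longrightarrow> E" "fa \<longrightarrow> \<not> F" "fb \<longrightarrow> F" "adj c d \<longrightarrow> C \<noteq> D"
      "adj e f \<longrightarrow> E \<noteq> F" "ce \<longrightarrow> C \<noteq> E" "cf \<longrightarrow> C \<noteq> F" "de \<longrightarrow> D \<noteq> E" "df \<longrightarrow> D \<noteq> F"
    by (elim exE conjE)
  note col = col[unfolded defs]
  have nadj: "C \<Longrightarrow> \<not> adj c a" "\<not> C \<Longrightarrow> \<not> adj c b" "c \<noteq> d \<Longrightarrow> D \<Longrightarrow> \<not> adj d a" "c \<noteq> d \<Longrightarrow> \<not> D \<Longrightarrow> \<not> adj d b"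
    "E \<Longrightarrow> \<not> adj e a" "\<not> E \<Longrightarrow> \<not> adj e b" "e \<noteq> f \<Longrightarrow> F \<Longrightarrow> \<not> adj f a" "e \<noteq> f \<Longrightarrow> \<not> F \<Longrightarrow> \<not> adj f b"
    "C = D \<Longrightarrow> \<not> adj c d" "E = F \<Longrightarrow> \<not> adj e f" "C = E \<Longrightarrow> \<not> adj c e" "e \<noteq> f \<Longrightarrow> C = F \<Longrightarrow> \<not> adj c f"
    "c \<noteq> d \<Longrightarrow> D = E \<Longrightarrow> \<not> adj d e" "c \<noteq> d \<Longrightarrow> e \<noteq> f \<Longrightarrow> D = F \<Longrightarrow> \<not> adj d f"
    using col by argo+
  note nadj' = nadj[unfolded adj_comm[of c a] adj_comm[of c b] adj_comm[of d a] adj_comm[of d b] adj_comm[of e a] adj_comm[of e b] adj_comm[of f a]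
    adj_comm[of f b] adj_comm[of c d] adj_comm[of e f] adj_comm[of c e] adj_comm[of c f] adj_comm[of d e] adj_comm[of d f]]
  define P where "P = {x. x = a \<or> x = c \<and> C \<or> x = d \<and> c \<noteq> d \<and> D \<or> x = e \<and> E \<or> x = f \<and> e \<noteq> f \<and> F}"
  define Q where "Q = {x. x = b \<or> x = c \<and> \<not> C \<or> x = d \<and> c \<noteq> d \<and> \<not> D \<or> x = e \<and> \<not> E \<or> x = f \<and> e \<noteq> f \<and> \<not> F}"
  have "{a, b, c, d, e, f} = P \<union> Q" unfolding P_def Q_def by auto
  moreover have "\<not> adj x y" if "x \<in> P" "y \<in> P" for x y
    using that unfolding P_def mem_Collect_eq by (elim disjE conjE) (simp_all add: nadj nadj')
  moreover have "\<not> adj x y" if "x \<in> Q" "y \<in> Q" for x y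
    using that unfolding Q_def mem_Collect_eq by (elim disjE conjE) (simp_all add: nadj nadj')
  ultimately show ?thesis by (rule bipI)
qed

text \<open>
  By \<open>common_3\<close>, a private neighbour of $u$ has at most one neighbour among the other neighbours of $v$, and
  conversely. If the common neighbours span no triangle, this sparsity makes the neighbourhood of the edge
  $uv$ bipartite, up to \<open>no_butterfly\<close>.
\<close>

lemma low_pair_common_triangle:
  assumes uv: "adj u v" and low: "deg u \<le> 5" "deg v \<le> 5"
    and a: "adj u a" "adj v a" and b: "adj u b" "adj v b" and ab: "adj a b"
  shows "\<not> triangle_free (nbs u \<inter> nbs v)"
proof
  assume tf: "triangle_free (nbs u \<inter> nbs v)"
  define M where "M = nbs u \<inter> nbs v"
  define C where "C = nbs u - {v} - M"
  define E where "E = nbs v - {u} - M"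
  have fin: "finite M" "finite C" "finite E" unfolding M_def C_def E_def by auto
  have uM: "u \<notin> M" "v \<notin> M" unfolding M_def by auto
  have Nu: "nbs u = insert v (M \<union> C)" and Nv: "nbs v = insert u (M \<union> E)"
    using uv adj_sym[OF uv] unfolding M_def C_def E_def by auto
  have cu: "deg u = Suc (card M + card C)" and cv: "deg v = Suc (card M + card E)"
  proof -
    have "M \<inter> C = {}" "M \<inter> E = {}" unfolding C_def E_def by blast+
    then have "card (M \<union> C) = card M + card C" "card (M \<union> E) = card M + card E"
      using fin card_Un_disjoint by blast+
    moreover have "v \<notin> M \<union> C" "u \<notin> M \<union> E" using uM by (auto simp: C_def E_def)
    ultimately show "deg u = Suc (card M + card C)" "deg v = Suc (card M + card E)"
      unfolding Nu Nv using fin by simp_all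
  qed
  have "a \<noteq> b" using ab by auto
  then have M2: "2 \<le> card M"
    using card_mono[OF fin(1), of "{a, b}"] a b unfolding M_def by simp
  have uvV: "u \<in> V" "v \<in> V" using uv adj_V by auto
  have one: "\<not> (adj c x \<and> adj c y)" if "c \<in> C" "x \<in> M \<union> E" "y \<in> M \<union> E" "x \<noteq> y" for c x y
  proof
    assume "adj c x \<and> adj c y"
    moreover have "x \<noteq> u" "y \<noteq> u" "adj v x" "adj v y"
      using that uM unfolding M_def E_def by auto
    ultimately have "adj c v"
      using common_3[of c u x y v] that uv adj_sym unfolding C_def by blast
    then show False using that(1) adj_sym unfolding C_def M_def by blast
  qed
  have one': "\<not> (adj c x \<and> adj c y)" if "c \<in> E" "x \<in> M \<union> C" "y \<in> M \<union> C" "x \<noteq> y" for c x y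
  proof
    assume "adj c x \<and> adj c y"
    moreover have "x \<noteq> v" "y \<noteq> v" "adj u x" "adj u y"
      using that uM unfolding M_def C_def by auto
    ultimately have "adj c u"
      using common_3[of c v x y u] that uv adj_sym unfolding E_def by blast
    then show False using that(1) adj_sym unfolding E_def M_def by blast
  qed
  have nb: "\<not> bip (M \<union> C \<union> E)"
  proof
    assume bip: "bip (M \<union> C \<union> E)"
    have "card ({u, v} \<union> (M \<union> C \<union> E)) \<le> card {u, v} + (card M + card C + card E)"
      using card_Un_le[of "{u, v}" "M \<union> C \<union> E"] card_Un_le[of "M \<union> C" E] card_Un_le[of M C] by linarith
    also have "card {u, v} \<le> 2" by (simp add: card_insert_le_m1)
    \<comment> \<open>The degree sum counts \<open>M\<close> twice. As \<open>M\<close> has at least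
      two elements and a degree 5 forces 9 vertices, some vertex is left over.\<close>
    finally have "card ({u, v} \<union> (M \<union> C \<union> E)) + card M \<le> deg u + deg v" using cu cv by linarith
    moreover have "deg u + deg v < card V + 2"
      using card_V_ge_8 card_V_ge_9[OF uvV(1)] card_V_ge_9[OF uvV(2)] low by (cases "5 \<le> deg u \<or> 5 \<le> deg v") auto
    ultimately have "card ({u, v} \<union> (M \<union> C \<union> E)) < card V" using M2 by linarith
    then show False
      using bip_cut[OF bip, of "{u, v}"] uvV Nu Nv fin by auto
  qed
  show False
  proof (cases "3 \<le> card M")
    case True
    \<comment> \<open>Each end now has at most one private neighbour, and adding a vertex with at
      most one neighbour keeps a set bipartite.\<close>
    have c1: "card C = 0 \<or> card C = 1" "card E = 0 \<or> card E = 1" using cu cv low True by linarith+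
    have M4: "card M \<le> 4" using cu low by linarith
    have "bip M" by (rule bip_four) (use tf fin M4 in \<open>simp_all add: M_def\<close>)
    have "bip (M \<union> C)"
    proof (cases "C = {}")
      case False
      then obtain c where c: "C = {c}" using c1(1) fin card_1_singletonE by auto
      have "bip (insert c M)"
        by (rule bip_insert[OF \<open>bip M\<close>]) (use one[of c] c in blast)
      then show ?thesis using c by simp
    qed (simp add: \<open>bip M\<close>)
    have "bip (M \<union> C \<union> E)"
    proof (cases "E = {}")
      case False
      then obtain e where e: "E = {e}" using c1(2) fin card_1_singletonE by auto
      have "bip (insert e (M \<union> C))"
        by (rule bip_insert[OF \<open>bip (M \<union> C)\<close>]) (use one'[of e] e in blast)
      then show ?thesis using e by simp
    qed (simp add: \<open>bip (M \<union> C)\<close>)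
    then show False using nb by simp
  next
    case False
    then have M: "card M = 2" using M2 by linarith
    have Mab: "M = {a, b}"
      using card_subset_eq[OF fin(1), of "{a, b}"] a b \<open>a \<noteq> b\<close> M unfolding M_def by simp
    \<comment> \<open>Degrees 4 and 5 leave one or two private neighbours; a single one is written
      as a pair with equal entries.\<close>
    have "card C \<le> 2" "card E \<le> 2" "C \<noteq> {}" "E \<noteq> {}"
      using cu cv low M deg_ge_4[OF uvV(1)] deg_ge_4[OF uvV(2)] by auto
    then obtain c d e f where cd: "C = {c, d}" and ef: "E = {e, f}"
      using nonempty_card_le_2 fin by meson
    have "bip {a, b, c, d, e, f}"
    proof (rule bip_pair_nbs)
      show "a \<noteq> b" by fact
      show "\<not> (adj c x \<and> adj c y) \<and> \<not> (adj d x \<and> adj d y)"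
        if "x \<in> {a, b, e, f}" "y \<in> {a, b, e, f}" "x \<noteq> y" for x y
        using one[of c x y] one[of d x y] that unfolding cd ef Mab by blast
      show "\<not> (adj e x \<and> adj e y) \<and> \<not> (adj f x \<and> adj f y)"
        if "x \<in> {a, b, c, d}" "y \<in> {a, b, c, d}" "x \<noteq> y" for x y
        using one'[of e x y] one'[of f x y] that unfolding cd ef Mab by blast
      show "{a, b} \<inter> {c, d} = {}" "{a, b} \<inter> {e, f} = {}" "{c, d} \<inter> {e, f} = {}"
        unfolding cd[symmetric] ef[symmetric] Mab[symmetric] C_def E_def M_def by auto
    next
      fix x y z p assume h: "adj x y" "{x, y} = {c, d}" "p \<in> {a, b}" "adj p x" "z \<in> {p, e, f}"
      obtain q where q: "M = {p, q}" "adj p q"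
      proof (cases "p = a")
        case True
        then show thesis using that[of b] Mab ab by simp
      next
        case False
        then have "p = b" using h(3) by simp
        then show thesis using that[of a] Mab adj_sym[OF ab] by (simp add: insert_commute)
      qed
      have "x \<noteq> y" using h(1) adj_irrefl by metis
      then have "card C = 2" using h(2) unfolding cd[symmetric] by (metis card_2_iff)
      then have "deg u = 5" using cu M by simp
      moreover have "nbs u = {v, p, q, x, y}" using Nu q h(2) cd by auto
      moreover have "adj v z" "z \<noteq> u" "z \<noteq> q"
      proof -
        have "z \<in> M \<union> E" using h(5) q ef by auto
        then show "adj v z" "z \<noteq> u" using Nv uM unfolding E_def by auto
        have "z \<in> E \<or> z = p" using h(5) ef by auto
        then show "z \<noteq> q" using q unfolding E_def by auto
      qed
      ultimately show "\<not> adj y z"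
        using no_butterfly_at_edge[OF uv q(1)[unfolded M_def] q(2), of x y z] h(1,4) by blast
    next
      fix x y z p assume h: "adj x y" "{x, y} = {e, f}" "p \<in> {a, b}" "adj p x" "z \<in> {p, c, d}"
      obtain q where q: "M = {p, q}" "adj p q"
      proof (cases "p = a")
        case True
        then show thesis using that[of b] Mab ab by simp
      next
        case False
        then have "p = b" using h(3) by simp
        then show thesis using that[of a] Mab adj_sym[OF ab] by (simp add: insert_commute)
      qed
      have "x \<noteq> y" using h(1) adj_irrefl by metis
      then have "card E = 2" using h(2) unfolding ef[symmetric] by (metis card_2_iff)
      then have "deg v = 5" using cv M by simp
      moreover have "nbs v = {u, p, q, x, y}" using Nv q h(2) ef by auto
      moreover have "adj u z" "z \<noteq> v" "z \<noteq> q"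
      proof -
        have "z \<in> M \<union> C" using h(5) q cd by auto
        then show "adj u z" "z \<noteq> v" using Nu uM unfolding C_def by auto
        have "z \<in> C \<or> z = p" using h(5) cd by auto
        then show "z \<noteq> q" using q unfolding C_def by auto
      qed
      moreover have "nbs v \<inter> nbs u = {p, q}" using q(1) unfolding M_def by blast
      ultimately show "\<not> adj y z"
        using no_butterfly_at_edge[OF adj_sym[OF uv] _ q(2), of x y z] h(1,4) by blast
    qed
    moreover have "M \<union> C \<union> E = {a, b, c, d, e, f}" unfolding Mab cd ef by auto
    ultimately show False using nb by simp
  qed
qed

section \<open>Low vertices of a K_5\<close>

definition clique :: "'a set \<Rightarrow> bool" where
  "clique K \<longleftrightarrow> (\<forall>x\<in>K. \<forall>y\<in>K. x \<noteq> y \<longrightarrow> adj x y)"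

lemma cliqueD: "clique K \<Longrightarrow> x \<in> K \<Longrightarrow> y \<in> K \<Longrightarrow> x \<noteq> y \<Longrightarrow> adj x y"
  unfolding clique_def by blast

text \<open>The neighbourhood of \<open>u\<close> is not a clique, so there is an outer neighbour
  \<open>e\<close>, nonadjacent to some \<open>y\<close> in \<open>K\<close>. If \<open>e\<close>
  saw another \<open>x\<close> in \<open>K\<close>, merging \<open>e\<close> into \<open>y\<close>
  would lose the edges to \<open>u\<close> and \<open>x\<close> and leave \<open>u\<close> with a
  clique of 4 neighbours: 6 edges for 2 vertices.\<close>

lemma K5_outer_nb:
  assumes K: "clique K" "card K = 5" and u: "u \<in> K" "deg u \<le> 5"
  shows "\<exists>e. e \<notin> K \<and> nbs u = insert e (K - {u}) \<and> deg u = 5 \<and> (\<forall>x\<in>K. adj e x \<longrightarrow> x = u)"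
proof -
  have fK: "finite K" using K(2) card.infinite by force
  have c4: "card (K - {u}) = 4" using u K(2) by simp
  have sub: "K - {u} \<subseteq> nbs u" using cliqueD[OF K(1) u(1)] by auto
  have "K - {u} \<noteq> {}" using c4 by (metis card.empty zero_neq_numeral)
  then obtain x0 where "x0 \<in> K - {u}" by blast
  then have "adj u x0" using sub by blast
  then have uV: "u \<in> V" by (rule adj_V)
  have nocl: "\<not> clique (nbs u)"
    using no_clique_nbs[OF uV] unfolding clique_def by blast
  have "deg u \<noteq> 4"
  proof
    assume "deg u = 4"
    then have "nbs u = K - {u}" using card_subset_eq[OF _ sub] c4 by simp
    then show False using nocl K(1) unfolding clique_def by blast
  qed
  then have d5: "deg u = 5" using u(2) deg_ge_4[OF uV] by linarith
  then have "card (nbs u - (K - {u})) = 1"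
    using card_Diff_subset[OF _ sub] fK c4 by simp
  then obtain e where e: "nbs u - (K - {u}) = {e}" by (rule card_1_singletonE)
  then have ue: "adj u e" and eK': "e \<notin> K - {u}" by blast+
  then have eu: "e \<noteq> u" using adj_neq by blast
  then have eK: "e \<notin> K" using eK' by blast
  have N: "nbs u = insert e (K - {u})" using e sub by blast
  have "x = u" if x: "x \<in> K" "adj e x" for x
  proof (rule ccontr)
    assume xu: "x \<noteq> u"
    have "\<exists>y\<in>K. \<not> adj e y"
    proof (rule ccontr)
      assume "\<not> ?thesis"
      then have h: "adj e y" "adj y e" if "y \<in> K" for y using that adj_sym[of e y] by blast+
      have "clique (nbs u)"
        unfolding N clique_def using h cliqueD[OF K(1)] by simp
      then show False using nocl by simp
    qed
    then obtain y where y: "y \<in> K" "\<not> adj e y" by blast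
    have yu: "y \<noteq> u" using y adj_sym[OF ue] by blast
    have yx: "y \<noteq> x" using y x by blast
    have ye: "y \<noteq> e" "x \<noteq> e" using y x eK by blast+
    have nye: "\<not> adj y e" using y adj_sym[of y e] by blast
    define R1 where "R1 = identify y e R"
    have uy: "adj u y" and yx1: "adj y x" using cliqueD[OF K(1)] u y x yu yx by auto
    have eV: "e \<in> V" "y \<in> V" using ue uy adj_V by blast+
    have G1: "uncut (V - {e}) R1"
      unfolding R1_def by (rule identify_uncut[OF uncut]) (use eV nye ye in auto)
    have "card R1 + 2 * card {u, x} \<le> card R"
      unfolding R1_def
      by (rule identify_card[OF sg ye(1)]) (use adj_sym[OF ue] adj_sym[OF uy] x yx1 in auto)
    then have C1: "card R1 + 4 \<le> card R" using xu by simp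
    have N1: "R1 `` {u} = K - {u}"
      unfolding R1_def using identify_Image[OF yu[symmetric] eu[symmetric], of R] N eK y yu by auto
    have G2: "uncut (V - {e} - {u}) (delete_vertex u R1)"
    proof (rule delete_vertex_uncut_clique[OF G1])
      fix p q assume "(u, p) \<in> R1" "(u, q) \<in> R1" "p \<noteq> q"
      then have "p \<in> K" "q \<in> K" "p \<noteq> q" using N1 by auto
      then show "(p, q) \<in> R1"
        unfolding R1_def by (intro identifyI cliqueD[OF K(1)]) (use eK in auto)
    qed
    have S1: "sgraph (V - {e}) R1" using G1 by (simp add: uncut_def)
    have cV: "card (V - {e} - {u}) + 2 = card V"
      using eV(1) uV eu card_V_ge_8 by (simp add: card_Diff_singleton_if)
    show False
      using reduction[OF G2 cV, of 6] delete_vertex_card[OF S1, of u] N1 c4 C1 card_V_ge_8 by simp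
  qed
  then show ?thesis using eK N d5 by blast
qed

text \<open>
  Identifying the outer neighbours of $u$ and $v$ with $c$ and $d$ and deleting $u$, $v$, $w$ loses 5 vertices and
  13 edges, where $13/5 > 80/31$ by the narrowest margin.
\<close>

lemma K5_no_three_low:
  assumes K: "clique {u, v, w, c, d}" and dist: "distinct [u, v, w, c, d]"
    and low: "deg u \<le> 5" "deg v \<le> 5" "deg w \<le> 5"
  shows False
proof -
  let ?K = "{u, v, w, c, d}"
  have cK: "card ?K = 5" using dist by simp
  have inK: "u \<in> ?K" "v \<in> ?K" "w \<in> ?K" "c \<in> ?K" "d \<in> ?K" by simp_all
  obtain e where e: "e \<notin> ?K" "nbs u = insert e (?K - {u})" "deg u = 5" "\<forall>x\<in>?K. adj e x \<longrightarrow> x = u"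
    using K5_outer_nb[OF K cK inK(1) low(1)] by (elim exE conjE)
  obtain f where f: "f \<notin> ?K" "nbs v = insert f (?K - {v})" "deg v = 5" "\<forall>x\<in>?K. adj f x \<longrightarrow> x = v"
    using K5_outer_nb[OF K cK inK(2) low(2)] by (elim exE conjE)
  obtain g where g: "g \<notin> ?K" "nbs w = insert g (?K - {w})" "deg w = 5" "\<forall>x\<in>?K. adj g x \<longrightarrow> x = w"
    using K5_outer_nb[OF K cK inK(3) low(3)] by (elim exE conjE)
  have ad: "adj u e" "adj v f" "adj w g" "adj u v" "adj u w" "adj u c" "adj u d" "adj v c" "adj v d"
    "adj w c" "adj w d" "adj v w" "adj c d"
    using e(2) f(2) g(2) dist cliqueD[OF K inK(4,5)] by auto
  note ad' = ad[THEN adj_sym]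
  have efg: "e \<noteq> f" "e \<noteq> g" "f \<noteq> g"
    using bspec[OF e(4) inK(2)] bspec[OF e(4) inK(3)] bspec[OF f(4) inK(3)] ad' dist by auto
  have non: "\<not> adj e c" "\<not> adj e d" "\<not> adj f c" "\<not> adj f d" "\<not> adj g c" "\<not> adj g d"
    using bspec[OF e(4) inK(4)] bspec[OF e(4) inK(5)] bspec[OF f(4) inK(4)] bspec[OF f(4) inK(5)]
      bspec[OF g(4) inK(4)] bspec[OF g(4) inK(5)] dist by auto
  then have non': "\<not> adj c e" "\<not> adj d e" "\<not> adj c f" "\<not> adj d f" "\<not> adj c g" "\<not> adj d g"
    using adj_comm by metis+
  have inV: "u \<in> V" "v \<in> V" "w \<in> V" "c \<in> V" "d \<in> V" "e \<in> V" "f \<in> V"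
    using ad adj_V by blast+
  have n9: "9 \<le> card V" using card_V_ge_9[OF inV(1)] e(3) by simp
  \<comment> \<open>Otherwise \<open>c\<close> with \<open>e\<close>, \<open>f\<close> and
    \<open>d\<close> with \<open>g\<close> would be the colour classes of a cut around
    \<open>u\<close>, \<open>v\<close>, \<open>w\<close>.\<close>
  have ef: "adj e f"
  proof (rule ccontr)
    assume n: "\<not> adj e f"
    then have n': "\<not> adj f e" using adj_comm by blast
    show False
    proof (rule cut[of "{u, v, w}" "{c, e, f}" "{d, g}" "{u, v, w, c, d, e, f, g}"])
      have "card {u, v, w, c, d, e, f, g} \<le> 8" by (simp add: card_insert_le_m1)
      then show "card {u, v, w, c, d, e, f, g} < card V" using n9 by linarith
      show "y \<in> {u, v, w} \<union> {c, e, f} \<union> {d, g}" if "x \<in> {u, v, w}" "adj x y" for x y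
      proof -
        have "y \<in> nbs u \<union> nbs v \<union> nbs w" using that by auto
        then show ?thesis using e(2) f(2) g(2) by blast
      qed
      show "\<not> adj x y" if "x \<in> {c, e, f}" "y \<in> {c, e, f}" for x y
        using that non non' n n' by auto
      show "\<not> adj x y" if "x \<in> {d, g}" "y \<in> {d, g}" for x y
        using that non non' by auto
    qed (use inV in auto)
  qed
  define R1 where "R1 = identify c e R"
  define R2 where "R2 = identify d f R1"
  have ne: "c \<noteq> e" "d \<noteq> f" "c \<noteq> f" "d \<noteq> e" "u \<noteq> e" "u \<noteq> f" "v \<noteq> e" "v \<noteq> f" "w \<noteq> e" "w \<noteq> f"
    "u \<noteq> g" "v \<noteq> g" "w \<noteq> g" "c \<noteq> g" "d \<noteq> g"
    using e(1) f(1) g(1) by auto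
  have dst: "u \<noteq> v" "u \<noteq> w" "u \<noteq> c" "u \<noteq> d" "v \<noteq> w" "v \<noteq> c" "v \<noteq> d" "w \<noteq> c" "w \<noteq> d" "c \<noteq> d"
    using dist by auto
  have G1: "uncut (V - {e}) R1"
    unfolding R1_def by (rule identify_uncut[OF uncut inV(4,6) ne(1) non'(1)])
  have "card R1 + 2 * card {u} \<le> card R"
    unfolding R1_def by (rule identify_card[OF sg ne(1)]) (use ad' in auto)
  then have C1: "card R1 + 2 \<le> card R" by simp
  have S1: "sgraph (V - {e}) R1" using G1 by (simp add: uncut_def)
  have "(d, f) \<notin> R1"
    unfolding R1_def identify_iff using non'(4) ne dst by auto
  then have G2: "uncut (V - {e} - {f}) R2"
    unfolding R2_def by (intro identify_uncut[OF G1]) (use inV ne efg in auto)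
  have "(d, v) \<in> R1" "(f, v) \<in> R1" "(d, c) \<in> R1"
    unfolding R1_def by (rule identifyI; use ad' ne efg in blast)+
  \<comment> \<open>The edge \<open>e f\<close> becomes an edge from \<open>f\<close> to
    \<open>c\<close>, which makes \<open>c\<close> a second common neighbour of \<open>d\<close> and
    \<open>f\<close>.\<close>
  moreover have "(f, c) \<in> R1"
    unfolding R1_def by (rule identifyI_right) (use adj_sym[OF ef] efg in auto)
  ultimately have "card R2 + 2 * card {v, c} \<le> card R1"
    unfolding R2_def by (intro identify_card[OF S1 ne(2)]) auto
  then have C2: "card R2 + 4 \<le> card R1" using dst by simp
  have S2: "sgraph (V - {e} - {f}) R2" using G2 by (simp add: uncut_def)
  have Nu: "nbs u = {v, w, c, d, e}" "nbs v = {u, w, c, d, f}" "nbs w = {u, v, c, d, g}"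
    using e(2) f(2) g(2) dst by auto
  have "R1 `` {u} = {v, w, c, d}" "R1 `` {v} = {u, w, c, d, f}" "R1 `` {w} = {u, v, c, d, g}"
    unfolding R1_def using ne efg dst
    by (simp_all add: identify_Image Nu) auto
  then have N2: "R2 `` {u} = {v, w, c, d}" "R2 `` {v} = {u, w, c, d}" "R2 `` {w} = {u, v, c, d, g}"
    unfolding R2_def using ne efg dst by (simp_all add: identify_Image)
  have G3: "uncut (V - {e} - {f} - {u}) (delete_vertex u R2)"
  proof (rule delete_vertex_uncut_clique[OF G2])
    fix p q assume "(u, p) \<in> R2" "(u, q) \<in> R2" and pq: "p \<noteq> q"
    then have "p \<in> {v, w, c, d}" "q \<in> {v, w, c, d}" using N2 by auto
    then have "adj p q" "p \<noteq> e" "p \<noteq> f" "q \<noteq> e" "q \<noteq> f"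
      using cliqueD[OF K _ _ pq] e(1) f(1) by auto
    then show "(p, q) \<in> R2"
      unfolding R2_def R1_def by (intro identifyI)
  qed
  have C3: "card (delete_vertex u R2) + 2 * 4 = card R2"
    using delete_vertex_card[OF S2, of u] N2 dst by simp
  have N3: "delete_vertex u R2 `` {v} = {w, c, d}" "delete_vertex u R2 `` {w} = {v, c, d, g}"
    using delete_vertex_Image[of v u R2] delete_vertex_Image[of w u R2] N2 dst ne by auto
  have G4: "uncut (V - {e} - {f} - {u} - {v}) (delete_vertex v (delete_vertex u R2))"
    by (rule delete_vertex_uncut_deg_3[OF G3]) (use N3 dst in simp)
  have C4: "card (delete_vertex v (delete_vertex u R2)) + 2 * 3 = card (delete_vertex u R2)"
    using delete_vertex_card[OF delete_vertex_sgraph[OF S2], of v u] N3 dst by simp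
  have N4: "delete_vertex v (delete_vertex u R2) `` {w} = {c, d, g}"
    using delete_vertex_Image[of w v "delete_vertex u R2"] N3 dst ne by auto
  have G5: "uncut (V - {e} - {f} - {u} - {v} - {w}) (delete_vertex w (delete_vertex v (delete_vertex u R2)))"
    by (rule delete_vertex_uncut_deg_3[OF G4]) (use N4 dst ne in simp)
  have C5: "card (delete_vertex w (delete_vertex v (delete_vertex u R2))) + 2 * 3 = card (delete_vertex v (delete_vertex u R2))"
    using delete_vertex_card[OF delete_vertex_sgraph[OF delete_vertex_sgraph[OF S2]], of w v u] N4 dst ne by simp
  have cV: "card (V - {e} - {f} - {u} - {v} - {w}) + 5 = card V"
    using inV dst ne efg n9 by (auto simp: card_Diff_singleton_if)
  \<comment> \<open>The losses are 1 + 2 + 4 + 3 + 3 = 13 edges, and 31 * 13 = 403 >= 400 = 80 *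
    5.\<close>
  show False
    using reduction[OF G5 cV, of 13] C1 C2 C3 C4 C5 n9 by simp
qed

section \<open>Low vertices have high neighbours\<close>

definition high :: "'a \<Rightarrow> 'a set" where
  "high x = {y \<in> nbs x. 6 \<le> deg y}"

lemma finite_high [simp]: "finite (high x)"
  by (rule finite_subset[OF _ finN[of x]]) (auto simp: high_def)

text \<open>The common neighbours contain a triangle, giving a K_5 in which \<open>x\<close> and
  \<open>t\<close> are already two low vertices; the other three must be high.\<close>

lemma low_low_triangle:
  assumes xt: "adj x t" and low: "deg x \<le> 5" "deg t \<le> 5"
    and a: "adj x a" "adj t a" and b: "adj x b" "adj t b" and ab: "adj a b"
  shows "deg x = 5" "3 \<le> card (high x)"
proof -
  obtain p q r where p: "adj x p" "adj t p" and q: "adj x q" "adj t q" and r: "adj x r" "adj t r"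
    and pqr: "adj p q" "adj q r" "adj p r"
    using low_pair_common_triangle[OF xt low a b ab] unfolding triangle_free_def by blast
  note ad = xt p q r pqr
  have dst: "distinct [x, t, p, q, r]" using ad[THEN adj_neq] by simp
  have cl: "clique {x, t, p, q, r}" unfolding clique_def using ad ad[THEN adj_sym] by simp
  have c5: "card {x, t, p, q, r} = 5" using dst by simp
  show "deg x = 5" using K5_outer_nb[OF cl c5 _ low(1)] by blast
  have high: "6 \<le> deg y" if y: "y \<in> {p, q, r}" for y
  proof (rule ccontr)
    assume n: "\<not> 6 \<le> deg y"
    obtain y' y'' where yy: "{p, q, r} = {y, y', y''}"
      using y by (metis insertE insert_commute singletonD)
    have e: "{x, t, y, y', y''} = {x, t, p, q, r}" using yy by simp
    have "card {x, t, y, y', y''} = length [x, t, y, y', y'']" using c5 unfolding e by simp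
    then have "distinct [x, t, y, y', y'']" using card_distinct[of "[x, t, y, y', y'']"] by simp
    then show False
      using K5_no_three_low[of x t y y' y''] cl low n unfolding e by simp
  qed
  then have "{p, q, r} \<subseteq> high x" unfolding high_def using p q r by auto
  then have "card {p, q, r} \<le> card (high x)" by (intro card_mono) auto
  then show "3 \<le> card (high x)" using dst by simp
qed

text \<open>Either the whole triangle is high, or a low vertex in it forms a low edge with
  \<open>x\<close> and \<open>low_low_triangle\<close> applies, forcing degree 5.\<close>

lemma triangle_high_nbs:
  assumes x: "deg x \<le> 5" and a: "adj x a" and b: "adj x b" and c: "adj x c"
    and abc: "adj a b" "adj b c" "adj a c"
  shows "3 \<le> card (high x)" "deg x = 4 \<Longrightarrow> 6 \<le> deg a"
proof -
  note sy = abc[THEN adj_sym]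
  have l: "deg x = 5 \<and> 3 \<le> card (high x)" if "deg a \<le> 5 \<or> deg b \<le> 5 \<or> deg c \<le> 5"
    using that low_low_triangle[OF a x _ b abc(1) c abc(3) abc(2)]
      low_low_triangle[OF b x _ a sy(1) c abc(2) abc(3)]
      low_low_triangle[OF c x _ a sy(3) b sy(2) abc(1)] by blast
  show "3 \<le> card (high x)"
  proof (cases "deg a \<le> 5 \<or> deg b \<le> 5 \<or> deg c \<le> 5")
    case False
    then have "{a, b, c} \<subseteq> high x" unfolding high_def using a b c by auto
    then have "card {a, b, c} \<le> card (high x)" by (intro card_mono) auto
    then show ?thesis using abc[THEN adj_neq] by simp
  qed (use l in blast)
  show "6 \<le> deg a" if "deg x = 4" using l that by linarith
qed

section \<open>Neighbourhoods of vertices of degree 4 and 5\<close>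

lemma not_bip_nbs:
  assumes "v \<in> V" "deg v \<le> 5" shows "\<not> bip (nbs v)"
proof
  assume "bip (nbs v)"
  moreover have "card ({v} \<union> nbs v) < card V"
    using card_V_ge_8 assms card_insert_if[of "nbs v" v] by simp
  ultimately show False using bip_cut[of "nbs v" "{v}"] assms by auto
qed

text \<open>If \<open>d\<close> saw two triangle vertices, it would share them and \<open>v\<close>
  with the third and see that one too by \<open>common_3\<close>, making the neighbourhood of
  \<open>v\<close> a clique.\<close>

lemma deg_4_triangle:
  assumes v: "deg v = 4" and a: "adj v a" and b: "adj v b" and c: "adj v c"
    and abc: "adj a b" "adj b c" "adj a c"
  obtains d where "nbs v = {a, b, c, d}" "d \<notin> {a, b, c}"
    "\<And>x y. x \<in> {a, b, c} \<Longrightarrow> y \<in> {a, b, c} \<Longrightarrow> adj d x \<Longrightarrow> adj d y \<Longrightarrow> x = y"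
    "6 \<le> deg a" "6 \<le> deg b" "6 \<le> deg c"
proof -
  note sy = abc[THEN adj_sym]
  have c3: "card {a, b, c} = 3" using abc[THEN adj_neq] by simp
  have sub: "{a, b, c} \<subseteq> nbs v" using a b c by auto
  then have "card (nbs v - {a, b, c}) = 1" using v c3 card_Diff_subset[of "{a, b, c}" "nbs v"] by simp
  then obtain d where d: "nbs v - {a, b, c} = {d}" by (rule card_1_singletonE)
  have N: "nbs v = {a, b, c, d}" using d sub by blast
  have dn: "d \<notin> {a, b, c}" and vd: "adj v d" using d by blast+
  have vV: "v \<in> V" using a by (rule adj_V)
  have cl: "\<not> (adj d a \<and> adj d b \<and> adj d c)"
  proof
    assume h: "adj d a \<and> adj d b \<and> adj d c"
    have "adj x y" if "adj v x" "adj v y" "x \<noteq> y" for x y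
    proof -
      have "x \<in> {a, b, c, d}" "y \<in> {a, b, c, d}" using that N by blast+
      then show ?thesis using h that(3) abc sy adj_sym[of d a] adj_sym[of d b] adj_sym[of d c] by auto
    qed
    then show False using no_clique_nbs[OF vV] by blast
  qed
  have two: "adj d z" if xyz: "{x, y, z} = {a, b, c}" "x \<noteq> y" and dx: "adj d x" "adj d y" for x y z
  proof -
    have "card {x, y, z} = 3" using xyz c3 by simp
    then have "x \<noteq> z" "y \<noteq> z" by (auto simp: card_insert_if split: if_splits)
    moreover have "clique {a, b, c}" unfolding clique_def using abc sy by simp
    ultimately have "adj z x" "adj z y" using cliqueD[of "{x, y, z}"] xyz(1) by auto
    moreover have z: "z \<in> {a, b, c}" "x \<in> {a, b, c}" "y \<in> {a, b, c}" using xyz(1) by blast+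
    then have "adj v z" "adj v x" "adj v y" "d \<noteq> z" using sub dn by auto
    ultimately show ?thesis
      using common_3[of d v x y z] adj_sym[of v d] adj_sym[of v z] adj_neq[of v x] adj_neq[of v y] dx vd xyz(2)
      by blast
  qed
  have one: "x = y" if xin: "x \<in> {a, b, c}" "y \<in> {a, b, c}" and dx: "adj d x" "adj d y" for x y
  proof (rule ccontr)
    assume xy: "x \<noteq> y"
    then obtain z where z: "{x, y, z} = {a, b, c}"
      using xin by (metis insertE insert_commute singletonD)
    then have "adj d z" using two[OF z xy] dx by blast
    then have "\<forall>w\<in>{x, y, z}. adj d w" using dx by simp
    then show False using cl unfolding z by simp
  qed
  have "6 \<le> deg a" "6 \<le> deg b" "6 \<le> deg c"
    using triangle_high_nbs(2)[OF _ a b c abc v] triangle_high_nbs(2)[OF _ b a c sy(1) abc(3,2) v]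
      triangle_high_nbs(2)[OF _ c a b sy(3) abc(1) sy(2) v] v by linarith+
  then show thesis using that[OF N dn one] by blast
qed

lemma deg_4_not_triangle_free:
  assumes "v \<in> V" "deg v = 4" shows "\<not> triangle_free (nbs v)"
  using not_bip_nbs[of v] bip_four[of "nbs v"] assms by auto

text \<open>With at most one rim neighbour, \<open>x\<close> could be coloured after the other four;
  with three or more, it has at most two non-neighbours. Both make the neighbourhood
  bipartite.\<close>

lemma rim_degree:
  assumes v: "v \<in> V" "deg v = 5" "triangle_free (nbs v)" and x: "adj v x"
  shows "card (nbs v \<inter> nbs x) = 2"
proof (rule ccontr)
  assume n: "card (nbs v \<inter> nbs x) \<noteq> 2"
  have "bip (nbs v)"
  proof (cases "card (nbs v \<inter> nbs x) \<le> 1")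
    case True
    have "triangle_free (nbs v - {x})" using v(3) unfolding triangle_free_def by blast
    then have "bip (nbs v - {x})" using bip_four[of "nbs v - {x}"] v(2) x by simp
    then show ?thesis using bip_leaf[of "nbs v" x] True x by simp
  next
    case False
    then have "card (nbs v - nbs x) \<le> 2"
      using n v(2) card_Diff_subset_Int[of "nbs v" "nbs x"] by simp
    then show ?thesis using bip_if_few_nonneighbours[OF v(3), of x] x by simp
  qed
  then show False using not_bip_nbs v by simp
qed

lemma wheel_path:
  assumes v: "v \<in> V" "deg v = 5" "triangle_free (nbs v)" and z: "adj v z"
  obtains s p q t where "distinct [z, s, p, q, t]" "nbs v = {z, s, p, q, t}"
    "adj z s" "adj s p" "adj p q" "adj q t" "adj t z"
    "\<not> adj z p" "\<not> adj z q" "\<not> adj s q" "\<not> adj s t" "\<not> adj p t"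
proof -
  define W where "W = nbs v"
  have two: "card (W \<inter> nbs x) = 2" if "x \<in> W" for x
    using rim_degree[OF v] that unfolding W_def by simp
  have c5: "card W = 5" and fW: "finite W" using v(2) unfolding W_def by simp_all
  have tf: "\<not> (adj x y \<and> adj y w \<and> adj x w)" if "x \<in> W" "y \<in> W" "w \<in> W" for x y w
    using v(3) that unfolding W_def triangle_free_def by blast
  have zW: "z \<in> W" using z unfolding W_def by simp
  obtain s t where st: "W \<inter> nbs z = {s, t}" "s \<noteq> t"
    using two[OF zW] by (meson card_2_iff)
  have s: "s \<in> W" "adj z s" "adj s z" and t: "t \<in> W" "adj z t" "adj t z"
    using st(1) adj_comm by blast+
  have nst: "\<not> adj s t" using tf[of z s t] zW s t by blast
  have "z \<in> W \<inter> nbs s" using zW s by simp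
  then obtain p where p: "W \<inter> nbs s = {z, p}" "z \<noteq> p" using other_of_card_2[OF two[OF s(1)]] by metis
  have "z \<in> W \<inter> nbs t" using zW t by simp
  then obtain q where q: "W \<inter> nbs t = {z, q}" "z \<noteq> q" using other_of_card_2[OF two[OF t(1)]] by metis
  have p': "p \<in> W" "adj s p" "adj p s" and q': "q \<in> W" "adj t q" "adj q t"
    using p(1) q(1) adj_comm by blast+
  have d: "z \<noteq> s" "z \<noteq> t" "s \<noteq> p" "t \<noteq> q" "p \<noteq> t" "q \<noteq> s"
    using s t p' q' nst adj_neq adj_comm[of s t] by blast+
  \<comment> \<open>Otherwise \<open>z\<close>, \<open>s\<close>, \<open>p\<close>, \<open>t\<close>
    close a 4-cycle that uses up their degrees and isolates the fifth vertex.\<close>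
  have pq: "p \<noteq> q"
  proof
    assume e: "p = q"
    have "s \<in> W \<inter> nbs p" "t \<in> W \<inter> nbs p" using s t p' q' e by auto
    then have Np: "W \<inter> nbs p = {s, t}"
      using st(2) other_of_card_2[OF two[OF p'(1)], of s] by (metis insertE singletonD)
    have "card {z, s, t, p} = 4" using d st(2) p(2) by simp
    moreover have "{z, s, t, p} \<subseteq> W" using zW s t p' by blast
    ultimately have "card (W - {z, s, t, p}) = 1" using c5 card_Diff_subset[of "{z, s, t, p}" W] by simp
    then obtain w where w: "W - {z, s, t, p} = {w}" by (rule card_1_singletonE)
    then have wW: "w \<in> W" and wn: "w \<notin> {z, s, t, p}" by blast+
    have "W \<inter> nbs w = {}"
    proof (rule ccontr)
      assume "W \<inter> nbs w \<noteq> {}"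
      then obtain y where y: "y \<in> W" "adj w y" by blast
      then have yw: "adj y w" by (simp add: adj_comm)
      have "y \<in> {z, s, t, p, w}" using y(1) w by blast
      moreover have "y \<noteq> w" using y(2) adj_neq by blast
      moreover have "w \<in> W \<inter> nbs y" using wW yw by simp
      ultimately show False using st(1) p(1) q(1) Np wn e by auto
    qed
    then show False using two[OF wW] by simp
  qed
  have dist: "distinct [z, s, p, q, t]" using d pq p(2) q(2) st(2) by auto
  have sub: "{z, s, p, q, t} \<subseteq> W" using zW s t p' q' by blast
  have N: "W = {z, s, p, q, t}"
    using card_subset_eq[OF fW sub] c5 dist by simp
  have npt: "\<not> adj p t"
  proof
    assume "adj p t"
    then have "p \<in> W \<inter> nbs t" using p' adj_comm[of p t] by simp
    then show False using q(1) pq p(2) by simp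
  qed
  have nzp: "\<not> adj z p"
  proof
    assume "adj z p"
    then have "p \<in> {s, t}" using p'(1) unfolding st(1)[symmetric] by simp
    then show False using d by simp
  qed
  have nzq: "\<not> adj z q"
  proof
    assume "adj z q"
    then have "q \<in> {s, t}" using q'(1) unfolding st(1)[symmetric] by simp
    then show False using d by simp
  qed
  have nsq: "\<not> adj s q"
  proof
    assume "adj s q"
    then have "q \<in> {z, p}" using q'(1) unfolding p(1)[symmetric] by simp
    then show False using pq q(2) by simp
  qed
  have apq: "adj p q"
  proof -
    have "s \<in> W \<inter> nbs p" using s p' by simp
    then obtain y where y: "W \<inter> nbs p = {s, y}" "s \<noteq> y" using other_of_card_2[OF two[OF p'(1)]] by metis
    then have "y \<in> W" "adj p y" by blast+
    then have "y \<in> {z, s, p, q, t}" "adj p y" using N by simp_all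
    then have "y = q" using y(2) npt nzp adj_comm[of p z] adj_neq[of p y] by auto
    then show ?thesis using \<open>adj p y\<close> by simp
  qed
  show thesis
    by (rule that[OF dist N[unfolded W_def] s(2) p'(2) apq q'(3) t(3) nzp nzq nsq nst npt])
qed

lemma high_of_triangle:
  assumes "deg x \<le> 5" "\<not> triangle_free (nbs x)" shows "3 \<le> card (high x)"
proof -
  obtain a b c where "adj x a" "adj x b" "adj x c" "adj a b" "adj b c" "adj a c"
    using assms(2) unfolding triangle_free_def by blast
  then show ?thesis using triangle_high_nbs(1)[OF assms(1)] by blast
qed

text \<open>At most two neighbours can be high, whereas a triangle in the neighbourhood would
  produce three.\<close>

lemma low_three_low:
  assumes y: "y \<in> V" "deg y \<le> 5" and low: "{a, b, c} \<subseteq> nbs y" "card {a, b, c} = 3"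
    "deg a \<le> 5" "deg b \<le> 5" "deg c \<le> 5"
  shows "deg y = 5" "triangle_free (nbs y)"
proof -
  have "high y \<subseteq> nbs y - {a, b, c}" using low unfolding high_def by auto
  then have "card (high y) \<le> card (nbs y - {a, b, c})" by (intro card_mono) auto
  also have "\<dots> = deg y - 3" using low card_Diff_subset[of "{a, b, c}" "nbs y"] by simp
  finally have "card (high y) < 3" using y by linarith
  then show tf: "triangle_free (nbs y)"
    using high_of_triangle[OF y(2)] by linarith
  have "deg y \<noteq> 4" using deg_4_not_triangle_free[OF y(1)] tf by blast
  then show "deg y = 5" using y deg_ge_4[OF y(1)] by linarith
qed

text \<open>Fixes the direction in which the pentagon is read when the two rim neighbours of
  \<open>v\<close> are already named.\<close>

lemma rim_path:
  assumes y: "y \<in> V" "deg y = 5" "triangle_free (nbs y)" and yv: "adj y v"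
    and st: "nbs y \<inter> nbs v = {s, t}"
  obtains p q where "distinct [v, s, p, q, t]" "nbs y = {v, s, p, q, t}"
    "adj s p" "adj p q" "adj q t" "\<not> adj v p" "\<not> adj v q" "\<not> adj s q" "\<not> adj p t"
proof -
  obtain s' p q t' where w: "distinct [v, s', p, q, t']" "nbs y = {v, s', p, q, t'}"
    "adj v s'" "adj s' p" "adj p q" "adj q t'" "adj t' v"
    "\<not> adj v p" "\<not> adj v q" "\<not> adj s' q" "\<not> adj s' t'" "\<not> adj p t'"
    by (rule wheel_path[OF y yv])
  have "s' \<in> nbs y \<inter> nbs v" "t' \<in> nbs y \<inter> nbs v" using w(2,3) adj_sym[OF w(7)] by auto
  then have "s' \<in> {s, t}" "t' \<in> {s, t}" unfolding st by simp_all
  moreover have "s' \<noteq> t'" using w(1) by simp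
  ultimately consider "s' = s" "t' = t" | "s' = t" "t' = s" by blast
  then show thesis
  proof cases
    case 1
    then show thesis using that[of p q] w by simp
  next
    case 2
    have "nbs y = {v, s, q, p, t}" using w(2) 2 by auto
    then show thesis
      using that[of q p] w 2 adj_comm[of q s] adj_comm[of q p] adj_comm[of p t] adj_comm[of t q] adj_comm[of s p]
      by auto
  qed
qed

text \<open>
  If at most one rim vertex $z$ of the pentagon $z,a,b,c,d$ around $v$ is high, then $b$ and $c$ are also centres
  of induced pentagons, and the hexagon $z,a,p,q,r,d$ around the triangle $v,b,c$ is a cut without chords
  joining vertices of the same colour.
\<close>

lemma high_of_deg_5:
  assumes v: "v \<in> V" "deg v = 5" shows "2 \<le> card (high v)"
proof (rule ccontr)
  assume n: "\<not> ?thesis"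
  have tf: "triangle_free (nbs v)"
    using high_of_triangle[of v] v n by linarith
  have "\<exists>z. adj v z \<and> high v \<subseteq> {z}"
  proof (cases "high v = {}")
    case True
    have "nbs v \<noteq> {}" using v(2) by (metis card.empty zero_neq_numeral)
    then show ?thesis using True by blast
  next
    case False
    then have "card (high v) = 1" using n card_gt_0_iff[of "high v"] by simp
    then obtain z where "high v = {z}" by (rule card_1_singletonE)
    then show ?thesis unfolding high_def by blast
  qed
  then obtain z where z: "adj v z" "high v \<subseteq> {z}" by blast
  obtain a b c d where w: "distinct [z, a, b, c, d]" "nbs v = {z, a, b, c, d}"
    "adj z a" "adj a b" "adj b c" "adj c d" "adj d z"
    "\<not> adj z b" "\<not> adj z c" "\<not> adj a c" "\<not> adj a d" "\<not> adj b d"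
    by (rule wheel_path[OF v tf z(1)])
  have low: "deg x \<le> 5" if "x \<in> {a, b, c, d}" for x
  proof -
    have "x \<in> nbs v" "x \<noteq> z" using that w by auto
    then have "x \<notin> high v" using z by blast
    then show ?thesis using \<open>x \<in> nbs v\<close> unfolding high_def by simp
  qed
  have va: "adj v a" "adj v b" "adj v c" "adj v d" using w(2) by auto
  note vs = va[THEN adj_sym] and va' = va[THEN adj_neq]
  note ws = w(3-7)[THEN adj_sym]
  have V: "b \<in> V" "c \<in> V" using va adj_V by blast+
  have "{v, a, c} \<subseteq> nbs b" "{v, b, d} \<subseteq> nbs c" using vs w ws by auto
  moreover have "card {v, a, c} = 3" "card {v, b, d} = 3" using va' w(1) by simp_all
  ultimately have b5: "deg b = 5" "triangle_free (nbs b)" and c5: "deg c = 5" "triangle_free (nbs c)"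
    using low_three_low[OF V(1)] low_three_low[OF V(2)] low v(2) by simp_all
  have mem: "x \<in> nbs v \<longleftrightarrow> x \<in> {z, a, b, c, d}" for x using w(2) by simp
  have bv: "nbs b \<inter> nbs v = {a, c}"
    unfolding w(2) using w ws adj_comm[of b z] adj_comm[of b d] by auto
  have cv: "nbs c \<inter> nbs v = {b, d}"
    unfolding w(2) using w ws adj_comm[of c z] adj_comm[of c a] by auto
  obtain p q where pq: "distinct [v, a, p, q, c]" "nbs b = {v, a, p, q, c}"
    "adj a p" "adj p q" "adj q c" "\<not> adj v p" "\<not> adj v q" "\<not> adj a q" "\<not> adj p c"
    by (rule rim_path[OF V(1) b5 vs(2) bv])
  obtain q' r where qr: "distinct [v, b, q', r, d]" "nbs c = {v, b, q', r, d}"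
    "adj b q'" "adj q' r" "adj r d" "\<not> adj v q'" "\<not> adj v r" "\<not> adj b r" "\<not> adj q' d"
    by (rule rim_path[OF V(2) c5 vs(3) cv])
  have cq': "adj c q'" using qr(2) by auto
  \<comment> \<open>On the rim of \<open>b\<close>, only \<open>v\<close> and \<open>q\<close> are
    adjacent to \<open>c\<close>, so the two pentagons share \<open>q\<close>.\<close>
  have "q' \<in> nbs b" using qr(3) by simp
  then have "q' \<in> {v, a, p, q, c}" using pq(2) by simp
  moreover have "q' \<noteq> v" using qr(1) by auto
  moreover have "q' \<noteq> a" using cq' w(10) adj_sym by blast
  moreover have "q' \<noteq> p" using adj_sym[OF cq'] pq(9) by blast
  moreover have "q' \<noteq> c" using adj_neq[OF cq'] by blast
  ultimately have qq: "q' = q" by blast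
  have br: "adj b p" "adj c r" using pq(2) qr(2) by auto
  note ps = pq(3-5)[THEN adj_sym] qr(4,5)[THEN adj_sym] br[THEN adj_sym]
  \<comment> \<open>Each edge within \<open>z\<close>, \<open>p\<close>, \<open>r\<close> would give
    a nonadjacent pair three common neighbours: \<open>p\<close>, \<open>v\<close> share
    \<open>a\<close>, \<open>b\<close>, \<open>z\<close>; \<open>r\<close>, \<open>v\<close> share
    \<open>c\<close>, \<open>d\<close>, \<open>z\<close>; \<open>p\<close>, \<open>c\<close> share
    \<open>b\<close>, \<open>q\<close>, \<open>r\<close>.\<close>
  have zp: "\<not> adj z p"
  proof
    assume "adj z p"
    then have "adj p v"
      using common_3[of p a b z v] ps(1) ps(6) adj_sym[of z p] va(1,2) z(1) w(1) pq(1) by auto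
    then show False using adj_sym[of p v] pq(6) by blast
  qed
  have zr: "\<not> adj z r"
  proof
    assume "adj z r"
    then have "adj r v"
      using common_3[of r c d z v] ps(7) qr(5) adj_sym[of z r] va(3,4) z(1) w(1) qr(1) by auto
    then show False using adj_sym[of r v] qr(7) by blast
  qed
  have pr: "\<not> adj p r"
  proof
    assume h: "adj p r"
    have "b \<noteq> q" "b \<noteq> r" "q \<noteq> r" "p \<noteq> c" using qr(1) pq(1) qq by auto
    then have "adj p c"
      using common_3[of p b q r c] ps(6) pq(4) h ws(3) adj_sym[OF pq(5)] br(2) by blast
    then show False using pq(9) by blast
  qed
  show False
  proof (rule cut[of "{v, b, c}" "{z, p, r}" "{a, q, d}" "{v, b, c, z, p, r, a, q, d}"])
    have "card {v, b, c} = 3" using va' w(1) by simp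
    moreover have "{v, b, c} \<subseteq> V" using v V by simp
    moreover have "5 \<le> deg x" if "x \<in> {v, b, c}" for x
      using that v(2) b5(1) c5(1) by auto
    \<comment> \<open>The cut and its inside occupy at most 9 vertices, so the three vertices of
      degree 5 are needed for the order bound.\<close>
    ultimately have "10 \<le> card V" using card_V_ge_10 by blast
    moreover have "card {v, b, c, z, p, r, a, q, d} \<le> 9" by (simp add: card_insert_le_m1)
    ultimately show "card {v, b, c, z, p, r, a, q, d} < card V" by linarith
    show "y \<in> {v, b, c} \<union> {z, p, r} \<union> {a, q, d}" if "x \<in> {v, b, c}" "adj x y" for x y
    proof -
      have "y \<in> nbs v \<union> nbs b \<union> nbs c" using that by auto
      then show ?thesis unfolding w(2) pq(2) qr(2) qq by blast
    qed
    show "\<not> adj x y" if "x \<in> {z, p, r}" "y \<in> {z, p, r}" for x y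
      using that zp zr pr adj_comm[of z p] adj_comm[of z r] adj_comm[of p r] by auto
    show "\<not> adj x y" if "x \<in> {a, q, d}" "y \<in> {a, q, d}" for x y
      using that w(11) pq(8) qr(9) qq adj_comm[of a d] adj_comm[of a q] adj_comm[of q d] by auto
  qed (use v V in auto)
qed

text \<open>Being low, \<open>f\<close> would be the neighbour of \<open>v\<close> outside its high
  triangle and see at most one triangle vertex, but the pentagon gives two common
  neighbours.\<close>

lemma deg_5_triangle_free_no_deg_4:
  assumes f: "f \<in> V" "deg f = 5" "triangle_free (nbs f)" and v: "adj f v" shows "deg v \<noteq> 4"
proof
  assume v4: "deg v = 4"
  have vV: "v \<in> V" using v by (rule adj_V)
  obtain a b c where abc: "adj v a" "adj v b" "adj v c" "adj a b" "adj b c" "adj a c"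
    using deg_4_not_triangle_free[OF vV v4] unfolding triangle_free_def by blast
  obtain d where d: "nbs v = {a, b, c, d}" "d \<notin> {a, b, c}"
    "\<And>x y. x \<in> {a, b, c} \<Longrightarrow> y \<in> {a, b, c} \<Longrightarrow> adj d x \<Longrightarrow> adj d y \<Longrightarrow> x = y"
    "6 \<le> deg a" "6 \<le> deg b" "6 \<le> deg c"
    using deg_4_triangle[OF v4 abc] by metis
  have "f \<in> nbs v" using adj_sym[OF v] by simp
  then have "f \<in> {a, b, c, d}" using d(1) by simp
  moreover have "f \<noteq> a" "f \<noteq> b" "f \<noteq> c" using d(4-6) f(2) by auto
  ultimately have fd: "f = d" by blast
  obtain x y where xy: "nbs f \<inter> nbs v = {x, y}" "x \<noteq> y"
    using rim_degree[OF f v] by (meson card_2_iff)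
  have "x \<in> {a, b, c}" "y \<in> {a, b, c}" "adj d x" "adj d y"
  proof -
    have xf: "adj f x" "adj f y" and "x \<in> nbs v" "y \<in> nbs v" using xy(1) by blast+
    then have "x \<in> {a, b, c, d}" "y \<in> {a, b, c, d}" using d(1) by simp_all
    then show "x \<in> {a, b, c}" "y \<in> {a, b, c}" "adj d x" "adj d y"
      using xf[THEN adj_neq] xf fd by auto
  qed
  then show False using d(3) xy(2) by blast
qed

text \<open>By \<open>common_3\<close> a twin would be adjacent to \<open>v\<close>, hence its
  fourth neighbour, which sees at most one triangle vertex. Distinct attached vertices thus use
  distinct pairs of high vertices.\<close>

lemma deg_4_no_twin:
  assumes v: "deg v = 4" and a: "adj v a" and b: "adj v b" and c: "adj v c"
    and abc: "adj a b" "adj b c" "adj a c" and w: "adj w a" "adj w b" "adj w c"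
  shows "w = v"
proof (rule ccontr)
  assume n: "w \<noteq> v"
  obtain d where d: "nbs v = {a, b, c, d}" "d \<notin> {a, b, c}"
    "\<And>x y. x \<in> {a, b, c} \<Longrightarrow> y \<in> {a, b, c} \<Longrightarrow> adj d x \<Longrightarrow> adj d y \<Longrightarrow> x = y"
    using deg_4_triangle[OF v a b c abc] by metis
  have ne: "a \<noteq> b" "a \<noteq> c" "b \<noteq> c" using abc[THEN adj_neq] by simp_all
  have "adj v w" using common_3[OF a b c w ne] n by blast
  then have "w \<in> {a, b, c, d}" using d(1) by auto
  then have "w = d" using w[THEN adj_neq] by blast
  then show False using d(3)[of a b] w ne by simp
qed

section \<open>Discharging\<close>

text \<open>
  Charges are scaled by $12 \cdot 31$, so that a vertex of degree $d$ starts with $186 d - 960$: the deficit is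
  $216 = 3 \cdot 72$ for degree 4 and $30 = 2 \cdot 15 \le 3 \cdot 10$ for degree 5.
\<close>

definition attached :: "'a \<Rightarrow> 'a \<Rightarrow> bool" where
  "attached v u \<longleftrightarrow> deg v = 4 \<and> adj v u \<and> (\<exists>x y. adj v x \<and> adj v y \<and> adj u x \<and> adj u y \<and> adj x y)"

text \<open>Two rates for degree 5 are needed: after serving two attached vertices, a vertex of
  degree 6 has 156 - 144 = 12 left, enough for 10 but not for 15.\<close>

definition demand :: "'a \<Rightarrow> 'a \<Rightarrow> nat" where
  "demand v u = (if attached v u then 72 else if deg v = 5 then if card (high v) = 2 then 15 else 10 else 0)"

lemma attachedE:
  assumes "attached v u"
  obtains x y where "deg v = 4" "adj v u" "adj v x" "adj v y" "adj u x" "adj u y" "adj x y"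
    "x \<in> high u" "y \<in> high u"
proof -
  obtain x y where h: "deg v = 4" "adj v u" "adj v x" "adj v y" "adj u x" "adj u y" "adj x y"
    using assms unfolding attached_def by blast
  then have "6 \<le> deg x" "6 \<le> deg y"
    using deg_4_triangle[OF h(1-4) h(5,7,6)] by metis+
  then show thesis using that[OF h] h unfolding high_def by simp
qed

lemma demand_low:
  assumes v: "v \<in> V" "deg v \<le> 5"
  shows "960 \<le> 186 * deg v + (\<Sum>u\<in>high v. demand v u)"
proof (cases "deg v = 4")
  case True
  obtain a b c where abc: "adj v a" "adj v b" "adj v c" "adj a b" "adj b c" "adj a c"
    using deg_4_not_triangle_free[OF v(1) True] unfolding triangle_free_def by blast
  note sy = abc(4-6)[THEN adj_sym]
  have at: "attached v a" "attached v b" "attached v c"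
    unfolding attached_def using True abc sy by blast+
  have "6 \<le> deg a" "6 \<le> deg b" "6 \<le> deg c"
    using deg_4_triangle[OF True abc] by metis+
  then have "{a, b, c} \<subseteq> high v" unfolding high_def using abc by auto
  then have "(\<Sum>u\<in>{a, b, c}. demand v u) \<le> (\<Sum>u\<in>high v. demand v u)"
    by (intro sum_mono2) auto
  moreover have "(\<Sum>u\<in>{a, b, c}. demand v u) = 216"
    using abc(4-6)[THEN adj_neq] at by (simp add: demand_def)
  ultimately show ?thesis using True by linarith
next
  case False
  then have d5: "deg v = 5" using deg_ge_4[OF v(1)] v(2) by linarith
  have "(\<Sum>u\<in>high v. demand v u) = card (high v) * (if card (high v) = 2 then 15 else 10)"
    using d5 by (simp add: demand_def attached_def)
  moreover have "2 \<le> card (high v)" by (rule high_of_deg_5[OF v(1) d5])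
  ultimately show ?thesis using d5 by (cases "card (high v) = 2") auto
qed

text \<open>In the pentagon case, \<open>u\<close> and its two rim neighbours are high:
  \<open>N\<close> leaves only degree 4 as an alternative, and \<open>f\<close> has no such
  neighbour.\<close>

lemma high_ge_3:
  assumes u: "6 \<le> deg u" and f: "adj u f" "deg f = 5"
    and N: "\<And>y. adj u y \<Longrightarrow> y = f \<or> deg y = 4 \<or> 6 \<le> deg y"
  shows "3 \<le> card (high f)"
proof (cases "triangle_free (nbs f)")
  case True
  have fV: "f \<in> V" using f(1) by (rule adj_V)
  have c2: "card (nbs f \<inter> nbs u) = 2" by (rule rim_degree[OF fV f(2) True adj_sym[OF f(1)]])
  have "insert u (nbs f \<inter> nbs u) \<subseteq> high f"
  proof
    fix y assume "y \<in> insert u (nbs f \<inter> nbs u)"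
    then consider "y = u" | "adj f y" "adj u y" by blast
    then show "y \<in> high f"
    proof cases
      case 1
      then show ?thesis using u adj_sym[OF f(1)] unfolding high_def by simp
    next
      case 2
      then show ?thesis
        using N[OF 2(2)] deg_5_triangle_free_no_deg_4[OF fV f(2) True 2(1)] adj_neq[OF 2(1)] unfolding high_def by auto
    qed
  qed
  then have "card (insert u (nbs f \<inter> nbs u)) \<le> card (high f)" by (intro card_mono) auto
  then show ?thesis using c2 by simp
next
  case False
  then show ?thesis using high_of_triangle[of f] f(2) by simp
qed

text \<open>High neighbours cost nothing, and attached vertices force them to exist: one needs a
  pair of high neighbours, two need different pairs and so three high neighbours.\<close>

lemma supply_high:
  assumes u: "6 \<le> deg u"
  shows "960 + (\<Sum>v\<in>nbs u. demand v u) \<le> 186 * deg u"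
proof -
  define K where "K = {v \<in> nbs u. attached v u}"
  define J where "J = {v \<in> nbs u. deg v = 5}"
  have sub: "K \<subseteq> nbs u" "J \<subseteq> nbs u" "high u \<subseteq> nbs u" unfolding K_def J_def high_def by auto
  have fin: "finite K" "finite J" using sub finite_subset[OF _ finN] by blast+
  have K4: "deg v = 4" if "v \<in> K" for v using that unfolding K_def attached_def by simp
  have disj: "K \<inter> J = {}" "(K \<union> J) \<inter> high u = {}" using K4 unfolding J_def high_def by force+
  have "card (K \<union> J \<union> high u) = card K + card J + card (high u)"
    using disj fin by (simp add: card_Un_disjoint)
  moreover have "card (K \<union> J \<union> high u) \<le> deg u" using sub by (intro card_mono) auto
  ultimately have tot: "card K + card J + card (high u) \<le> deg u" by linarith
  have "(\<Sum>v\<in>nbs u. demand v u) = (\<Sum>v\<in>K \<union> J. demand v u)"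
    by (rule sum.mono_neutral_right) (use sub in \<open>auto simp: K_def J_def demand_def\<close>)
  also have "\<dots> = (\<Sum>v\<in>K. demand v u) + (\<Sum>v\<in>J. demand v u)"
    by (rule sum.union_disjoint[OF fin disj(1)])
  also have "(\<Sum>v\<in>K. demand v u) = 72 * card K" by (simp add: K_def demand_def)
  finally have S: "(\<Sum>v\<in>nbs u. demand v u) = 72 * card K + (\<Sum>v\<in>J. demand v u)" .
  have "(\<Sum>v\<in>J. demand v u) \<le> (\<Sum>v\<in>J. 15)"
    by (intro sum_mono) (auto simp: J_def demand_def attached_def)
  then have J15: "(\<Sum>v\<in>J. demand v u) \<le> 15 * card J" by simp
  have pair: "\<exists>x y. adj v x \<and> adj v y \<and> adj u x \<and> adj u y \<and> adj x y \<and> x \<in> high u \<and> y \<in> high u \<and> x \<noteq> y \<and>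
      (\<forall>w. adj w u \<longrightarrow> adj w x \<longrightarrow> adj w y \<longrightarrow> w = v)" if v: "v \<in> K" for v
  proof -
    have "attached v u" using v unfolding K_def by simp
    then obtain x y where h: "deg v = 4" "adj v u" "adj v x" "adj v y" "adj u x" "adj u y" "adj x y"
      "x \<in> high u" "y \<in> high u" by (rule attachedE)
    then show ?thesis using deg_4_no_twin[OF h(1-4) h(5,7,6)] adj_neq[OF h(7)] by blast
  qed
  have Ku: "adj v u" if "v \<in> K" for v using that unfolding K_def attached_def by simp
  have hi2: "2 \<le> card (high u)" if K0: "K \<noteq> {}"
  proof -
    obtain v where "v \<in> K" using K0 by blast
    from pair[OF this] obtain x y where "x \<in> high u" "y \<in> high u" "x \<noteq> y" by blast
    then have "card {x, y} \<le> card (high u)" by (intro card_mono) auto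
    then show ?thesis using \<open>x \<noteq> y\<close> by simp
  qed
  have hi3: "3 \<le> card (high u)" if K2: "2 \<le> card K"
  proof (rule ccontr)
    assume "\<not> ?thesis"
    then have c2: "card (high u) \<le> 2" by simp
    have "\<not> (\<forall>a\<in>K. \<forall>b\<in>K. a = b)"
      using K2 card_le_Suc0_iff_eq[OF fin(1)] by simp
    then obtain v w where vw: "v \<in> K" "w \<in> K" "v \<noteq> w" by blast
    obtain x y where xy: "adj v x" "adj v y" "x \<in> high u" "y \<in> high u" "x \<noteq> y"
      "\<And>w. adj w u \<Longrightarrow> adj w x \<Longrightarrow> adj w y \<Longrightarrow> w = v" using pair[OF vw(1)] by blast
    obtain x' y' where xy': "adj w x'" "adj w y'" "x' \<in> high u" "y' \<in> high u" "x' \<noteq> y'"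
      using pair[OF vw(2)] by blast
    have "{x, y} = high u" by (rule card_seteq) (use xy c2 in auto)
    then have "x' \<in> {x, y}" "y' \<in> {x, y}" using xy' by simp_all
    then have "adj w x" "adj w y" using xy'(1,2,5) by auto
    then show False using xy(6) Ku[OF vw(2)] vw(3) by blast
  qed
  show ?thesis
  proof (cases "card K \<le> 1")
    case True
    then consider "card K = 0" | "card K = 1" by linarith
    then show ?thesis
    proof cases
      case 1
      then show ?thesis using S J15 tot u by linarith
    next
      case 2
      then have "2 \<le> card (high u)" using hi2 by force
      then show ?thesis using S J15 tot u 2 by linarith
    qed
  next
    case False
    then have h3: "3 \<le> card (high u)" using hi3 by linarith
    show ?thesis
    proof (cases "7 \<le> deg u")
      case True
      \<comment> \<open>72 * (d - 3) <= 186 * d - 960 holds from d = 7 on, but not for d =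
        6.\<close>
      then show ?thesis using S J15 tot h3 by linarith
    next
      case f6: False
      then have d6: "deg u = 6" using u by linarith
      \<comment> \<open>Three attached vertices would use all three pairs of the high neighbours
        \<open>x\<close>, \<open>y\<close>, \<open>z\<close>. Then \<open>z\<close> is adjacent to
        \<open>u\<close>, \<open>x\<close>, \<open>y\<close>, making it a twin of \<open>v1\<close>,
        although \<open>z\<close> is high.\<close>
      have K2: "card K = 2"
      proof (rule ccontr)
        assume "card K \<noteq> 2"
        then have K3: "card K = 3" "card (high u) = 3" using False tot h3 d6 by linarith+
        then obtain v1 v2 v3 where v: "K = {v1, v2, v3}" "v1 \<noteq> v2" "v1 \<noteq> v3" "v2 \<noteq> v3"
          by (auto simp: card_3_iff)
        have vK: "v1 \<in> K" "v2 \<in> K" "v3 \<in> K" using v by auto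
        obtain x y where xy: "adj v1 x" "adj v1 y" "adj u x" "adj u y" "x \<in> high u" "y \<in> high u" "x \<noteq> y"
          "\<And>w. adj w u \<Longrightarrow> adj w x \<Longrightarrow> adj w y \<Longrightarrow> w = v1" using pair[OF vK(1)] by blast
        obtain x2 y2 where 2: "adj v2 x2" "adj v2 y2" "adj x2 y2" "x2 \<in> high u" "y2 \<in> high u" "x2 \<noteq> y2"
          "\<And>w. adj w u \<Longrightarrow> adj w x2 \<Longrightarrow> adj w y2 \<Longrightarrow> w = v2" using pair[OF vK(2)] by blast
        obtain x3 y3 where 3: "adj v3 x3" "adj v3 y3" "adj x3 y3" "x3 \<in> high u" "y3 \<in> high u" "x3 \<noteq> y3"
          using pair[OF vK(3)] by blast
        have "card (high u - {x, y}) = 1" using K3(2) xy card_Diff_subset[of "{x, y}" "high u"] by simp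
        then obtain z where z: "high u - {x, y} = {z}" by (rule card_1_singletonE)
        then have H: "high u = {x, y, z}" and zu: "z \<in> high u" using xy by blast+
        have n2: "\<not> (adj v2 x \<and> adj v2 y)" using xy(8)[OF Ku[OF vK(2)]] v(2) by blast
        have n3: "\<not> (adj v3 x \<and> adj v3 y)" using xy(8)[OF Ku[OF vK(3)]] v(3) by blast
        have n23: "\<not> (adj v3 x2 \<and> adj v3 y2)" using 2(7)[OF Ku[OF vK(3)]] v(4) by blast
        have m2: "x2 \<in> {x, y, z}" "y2 \<in> {x, y, z}" and m3: "x3 \<in> {x, y, z}" "y3 \<in> {x, y, z}"
          using 2 3 H by simp_all
        have "adj z x \<and> adj z y"
          using m2 m3 n2 n3 n23 2(1-3,6) 3(1-3,6) adj_comm[of x z] adj_comm[of y z]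
          by (elim insertE emptyE) (simp_all)
        moreover have "adj z u" using zu adj_sym[of u z] unfolding high_def by simp
        ultimately have "z = v1" using xy(8) by blast
        then show False using K4[OF vK(1)] zu unfolding high_def by simp
      qed
      \<comment> \<open>At most one place is left for degree 5, and then all other neighbours have
        degree 4 or are high, so \<open>high_ge_3\<close> gives the rate 10.\<close>
      have "(\<Sum>v\<in>J. demand v u) \<le> 12"
      proof (cases "J = {}")
        case False
        then have "card J \<noteq> 0" using fin by simp
        then have c: "card J = 1" "card (high u) = 3" using tot h3 d6 K2 by linarith+
        then obtain f where f: "J = {f}" using card_1_singletonE by blast
        have "K \<union> J \<union> high u = nbs u"
          using \<open>card (K \<union> J \<union> high u) = _\<close> sub c K2 d6 by (intro card_subset_eq) auto
        then have N: "y = f \<or> deg y = 4 \<or> 6 \<le> deg y" if "adj u y" for y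
          using that K4[of y] f unfolding high_def by blast
        have uf: "adj u f" "deg f = 5" using f unfolding J_def by auto
        have "3 \<le> card (high f)" by (rule high_ge_3[OF u uf N])
        then show ?thesis using f uf by (simp add: demand_def attached_def)
      qed simp
      then show ?thesis using S K2 d6 by simp
    qed
  qed
qed

text \<open>Transferred charge cancels in the sum over all vertices, leaving
  \<open>960 * card V \<le> 186 * card R\<close>, against six times \<open>sparse\<close>.\<close>

lemma counterexample_absurd: False
proof -
  define D where "D v u = (if adj v u \<and> deg v \<le> 5 \<and> 6 \<le> deg u then demand v u else 0)" for v u
  have loc: "960 + (\<Sum>v\<in>V. D v x) \<le> 186 * deg x + (\<Sum>u\<in>V. D x u)" if x: "x \<in> V" for x
  proof (cases "deg x \<le> 5")
    case True
    have "(\<Sum>u\<in>V. D x u) = (\<Sum>u\<in>high x. demand x u)"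
    proof -
      have "(\<Sum>u\<in>V. D x u) = (\<Sum>u\<in>high x. D x u)"
        by (rule sum.mono_neutral_right) (use adj_V in \<open>auto simp: high_def D_def\<close>)
      also have "\<dots> = (\<Sum>u\<in>high x. demand x u)"
        by (rule sum.cong) (use True in \<open>auto simp: high_def D_def\<close>)
      finally show ?thesis .
    qed
    moreover have "(\<Sum>v\<in>V. D v x) = 0" using True by (simp add: D_def)
    ultimately show ?thesis using demand_low[OF x True] by simp
  next
    case False
    have "(\<Sum>v\<in>V. D v x) = (\<Sum>v\<in>nbs x. D v x)"
    proof (rule sum.mono_neutral_right)
      show "nbs x \<subseteq> V" using adj_V by blast
      show "\<forall>v\<in>V - nbs x. D v x = 0" using adj_comm[of _ x] by (simp add: D_def)
    qed simp
    also have "\<dots> \<le> (\<Sum>v\<in>nbs x. demand v x)"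
      by (intro sum_mono) (simp add: D_def)
    finally show ?thesis using supply_high[of x] False by linarith
  qed
  have "(\<Sum>x\<in>V. 960 + (\<Sum>v\<in>V. D v x)) \<le> (\<Sum>x\<in>V. 186 * deg x + (\<Sum>u\<in>V. D x u))"
    by (rule sum_mono) (use loc in blast)
  moreover have "(\<Sum>x\<in>V. \<Sum>v\<in>V. D v x) = (\<Sum>x\<in>V. \<Sum>u\<in>V. D x u)" by (rule sum.swap)
  ultimately have "960 * card V \<le> 186 * (\<Sum>x\<in>V. deg x)"
    by (simp add: sum.distrib sum_distrib_left)
  then show False using sparse card_degree_sum[OF sg] by simp
qed

end

lemma uncut_card_ge:
  fixes V :: "'a set" and R :: "'a rel"
  assumes "uncut V R" "4 \<le> card V"
  shows "160 * card V \<le> 31 * card R + 268"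
  using assms
proof (induction "card V" arbitrary: V R rule: less_induct)
  case less
  show ?case
  proof (rule ccontr)
    assume "\<not> ?case"
    then have "minimal_counterexample V R"
      unfolding minimal_counterexample_def using less by auto
    then show False by (rule minimal_counterexample.counterexample_absurd)
  qed
qed

section \<open>Transfer to digraphs\<close>

lemma card_arcs_ends_le:
  fixes G :: "('a, 'b) pre_digraph"
  assumes "finite (arcs G)"
  shows "card (arcs_ends G) \<le> 2 * card (edge_set G)"
proof -
  have "arcs_ends G \<subseteq> (\<Union>e\<in>edge_set G. {(x, y). e = {x, y}})"
    by (auto simp: arcs_ends_def arc_to_ends_def edge_set_def)
  moreover have fin: "finite {(x, y). e = {x, y}}" "card {(x, y). e = {x, y}} \<le> 2"
    if e: "e \<in> edge_set G" for e :: "'a set"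
  proof -
    obtain u v where "e = {u, v}" using e unfolding edge_set_def by blast
    then have sub: "{(x, y). e = {x, y}} \<subseteq> {(u, v), (v, u)}" by (auto simp: doubleton_eq_iff)
    show "finite {(x, y). e = {x, y}}" by (rule finite_subset[OF sub]) simp
    have "card {(x, y). e = {x, y}} \<le> card {(u, v), (v, u)}" by (rule card_mono[OF _ sub]) simp
    then show "card {(x, y). e = {x, y}} \<le> 2" by (auto simp: card_insert_if split: if_splits)
  qed
  moreover have finE: "finite (edge_set G)" using assms by (simp add: edge_set_def)
  ultimately have "card (arcs_ends G) \<le> card (\<Union>e\<in>edge_set G. {(x, y). e = {x, y}})"
    by (intro card_mono finite_UN_I)
  also have "\<dots> \<le> (\<Sum>e\<in>edge_set G. card {(x, y). e = {x, y}})"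
    by (rule card_UN_le[OF finE])
  also have "\<dots> \<le> (\<Sum>e\<in>edge_set G. 2)" by (rule sum_mono) (rule fin(2))
  finally show ?thesis by simp
qed

text \<open>Outside the cut no arc joins \<open>Lft\<close> to \<open>Rgt\<close>, so everything
  reachable from \<open>x\<close> keeps the label \<open>Lft\<close>.\<close>

lemma bipartite_cut_of_labelling:
  assumes "wf_digraph G" and f: "labelling (arcs_ends G) f"
    and xy: "x \<in> verts G" "f x = Lft" "y \<in> verts G" "f y = Rgt"
  shows "bipartite_cut G {v \<in> verts G. f v = Zero \<or> f v = One}"
proof -
  let ?M = "{v \<in> verts G. f v = Zero \<or> f v = One}"
  let ?H = "G \<restriction> (verts G - ?M)"
  have ok: "\<not> conflict (f (tail G e)) (f (head G e))" if "e \<in> arcs G" for e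
    using f that unfolding labelling_def arcs_ends_def arc_to_ends_def by blast
  have "\<not> Digraph_Component.connected ?H"
  proof
    assume "Digraph_Component.connected ?H"
    then have "(x, y) \<in> rtrancl_on (verts ?H) (parcs (mk_symmetric ?H))"
      unfolding Digraph_Component.connected_def strongly_connected_def reachable_def using xy by simp
    then have "f y = Lft"
    proof (induction rule: rtrancl_on_induct)
      case base
      then show ?case using xy by simp
    next
      case (step u v)
      then obtain e where e: "e \<in> arcs G" "tail G e \<notin> ?M" "head G e \<notin> ?M" "tail G e \<in> verts G" "head G e \<in> verts G"
        "u = tail G e \<and> v = head G e \<or> u = head G e \<and> v = tail G e"
        by (auto simp: parcs_mk_symmetric induce_subgraph_def)
      then show ?case
        using ok[OF e(1)] step.IH by (cases "f v") auto
    qed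
    then show False using xy by simp
  qed
  moreover have "verts ?H \<noteq> {}" using xy by auto
  ultimately have "vertex_cut G ?M" unfolding vertex_cut_def disconnected_def by blast
  moreover have "bipartite (G \<restriction> ?M)"
    unfolding bipartite_def
  proof (intro exI conjI ballI)
    show "verts (G \<restriction> ?M) = {v \<in> verts G. f v = Zero} \<union> {v \<in> verts G. f v = One}" by auto
    show "{v \<in> verts G. f v = Zero} \<inter> {v \<in> verts G. f v = One} = {}" by auto
    fix e assume "e \<in> arcs (G \<restriction> ?M)"
    then have "e \<in> arcs G" "tail G e \<in> ?M" "head G e \<in> ?M" by (auto simp: induce_subgraph_def)
    then show "tail (G \<restriction> ?M) e \<in> {v \<in> verts G. f v = Zero} \<and> head (G \<restriction> ?M) e \<in> {v \<in> verts G. f v = One} \<or>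
        tail (G \<restriction> ?M) e \<in> {v \<in> verts G. f v = One} \<and> head (G \<restriction> ?M) e \<in> {v \<in> verts G. f v = Zero}"
      using ok[of e] by (auto simp: induce_subgraph_def)
  qed
  ultimately show ?thesis unfolding bipartite_cut_def by blast
qed

theorem theorem3:
  fixes G :: "('a, 'b) pre_digraph" and n :: nat
  assumes "Digraph.graph G"
    and "card (verts G) = n"
    and "n \<ge> 4"
    and "real (card (edge_set G)) < (80 * real n - 134) / 31"
  shows "\<exists>M. bipartite_cut G M"
proof -
  interpret graph G by fact
  let ?R = "arcs_ends G"
  have sg: "sgraph (verts G) ?R"
    unfolding sgraph_def
  proof (intro conjI)
    show "?R \<subseteq> verts G \<times> verts G" by (auto simp: arcs_ends_def arc_to_ends_def)
    show "sym ?R" using sym_arcs by (simp add: symmetric_def)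
    show "irrefl ?R" using no_loops by (auto simp: irrefl_def arcs_ends_def arc_to_ends_def)
  qed simp
  have "31 * real (card (edge_set G)) < 80 * real n - 134" using assms(4) by (simp add: field_simps)
  then have "31 * (2 * card (edge_set G)) + 268 < 160 * n" by linarith
  then have "31 * card ?R + 268 < 160 * card (verts G)"
    using card_arcs_ends_le[OF finite_arcs] assms(2) by linarith
  then have "\<not> uncut (verts G) ?R" using uncut_card_ge assms(2,3) by fastforce
  then obtain f where f: "labelling ?R f" and LR: "Lft \<in> f ` verts G" "Rgt \<in> f ` verts G"
    unfolding uncut_def using sg by blast
  obtain x where x: "x \<in> verts G" "f x = Lft" using LR(1) by (rule imageE) simp
  obtain y where y: "y \<in> verts G" "f y = Rgt" using LR(2) by (rule imageE) simp
  show ?thesis by (rule exI) (rule bipartite_cut_of_labelling[OF wf_digraph_axioms f x y])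
qed

end
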